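(* Let $f\in\mathbb{C}[x,y]$ be a nonzero binary form of degree $6$ all of whose roots in $\mathbb{P}^1$ have multiplicity at most $2$. Then the following hold. (1) If $f$ has three double roots, then $\operatorname{rank} f=4$. (2) If $f$ has exactly two double roots, then $3\le \operatorname{rank} f\le 4$, and both values $3$ and $4$ are attained by such forms. (3) If $f$ has exactly one double root, then $3\le \operatorname{rank} f\le 5$, and each of the values $3,4,5$ is attained by such forms. (4) If $f$ has six distinct roots, then $2\le \operatorname{rank} f\le 5$, and each of the values $2,3,4,5$ is attained by such forms.
   Context: For a nonzero homogeneous polynomial (binary form) $f\in\mathbb{C}[x,y]$ of degree $d$, the Waring rank $\operatorname{rank} f$ is the minimal integer $r$ such that $f=\ell_1^d+\cdots+\ell_r^d$ for some linear forms $\ell_1,\dots,\ell_r\in\mathbb{C}[x,y]$. A root of $f$ of multiplicity $m$ is a point of $\mathbb{P}^1$ at which $f$ vanishes to order exactly $m$, i.e. a linear factor (up to scalar) occurring in $f$ with exact exponent $m$; a double root is a root of multiplicity $2$. *)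

theory Defs
  imports "HOL-Computational_Algebra.Computational_Algebra"
    "HOL-Computational_Algebra.Field_as_Ring"
begin

text \<open>
  \<open>\<complex>[x,y]\<close> is rendered as \<open>\<complex>[x][y]\<close>, the type \<^typ>\<open>complex poly poly\<close>:
  the inner polynomials are in \<open>x\<close>, the outer variable is \<open>y\<close>, so
  \<^term>\<open>coeff (coeff f j) i\<close> is the coefficient of \<open>x\<^sup>i y\<^sup>j\<close>.
\<close>

definition var_x :: "complex poly poly" where
  "var_x = [:[:0, 1:]:]"

definition var_y :: "complex poly poly" where
  "var_y = [:0, 1:]"

definition scalar :: "complex \<Rightarrow> complex poly poly" where
  "scalar c = [:[:c:]:]"

text \<open>As usual the zero polynomial counts as homogeneous of every degree.\<close>

definition binary_form :: "nat \<Rightarrow> complex poly poly \<Rightarrow> bool" where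
  "binary_form d f \<longleftrightarrow> (\<forall>i j. coeff (coeff f j) i \<noteq> 0 \<longrightarrow> i + j = d)"

definition linear_form :: "complex poly poly \<Rightarrow> bool" where
  "linear_form l \<longleftrightarrow> (\<exists>a b. l = scalar a * var_x + scalar b * var_y)"

text \<open>
  The degree \<open>d\<close> is an argument; it is determined by \<open>f\<close> when \<open>f\<close> is a nonzero
  form. Every binary form over \<open>\<complex>\<close> has a Waring decomposition, so the
  \<open>LEAST\<close> is attained.
\<close>

definition waring_rank :: "nat \<Rightarrow> complex poly poly \<Rightarrow> nat" where
  "waring_rank d f =
     (LEAST r. \<exists>l. (\<forall>i<r. linear_form (l i)) \<and> f = (\<Sum>i<r. l i ^ d))"

definition proj_rel :: "((complex \<times> complex) \<times> (complex \<times> complex)) set" where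
  "proj_rel = {((a, b), (a', b')). (a, b) \<noteq> (0, 0) \<and>
     (\<exists>c. c \<noteq> 0 \<and> a' = c * a \<and> b' = c * b)}"

definition P1 :: "(complex \<times> complex) set set" where
  "P1 = (UNIV - {(0, 0)}) // proj_rel"

text \<open>
  The order of vanishing of \<open>f\<close> at \<open>[a : b]\<close> is the exact exponent in \<open>f\<close> of the
  linear form \<open>b x - a y\<close>, which vanishes precisely at \<open>[a : b]\<close>. The lemma
  \<open>root_mult_class\<close> below says that it does not depend on the representative.
\<close>

definition root_mult :: "complex poly poly \<Rightarrow> (complex \<times> complex) set \<Rightarrow> nat" where
  "root_mult f p =
     the_elem ((\<lambda>(a, b). multiplicity (scalar b * var_x - scalar a * var_y) f) ` p)"

definition roots :: "complex poly poly \<Rightarrow> (complex \<times> complex) set set" where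
  "roots f = {p \<in> P1. root_mult f p \<ge> 1}"

definition double_roots :: "complex poly poly \<Rightarrow> (complex \<times> complex) set set" where
  "double_roots f = {p \<in> P1. root_mult f p = 2}"

definition sextic_mult_le_2 :: "complex poly poly \<Rightarrow> bool" where
  "sextic_mult_le_2 f \<longleftrightarrow>
     f \<noteq> 0 \<and> binary_form 6 f \<and> (\<forall>p \<in> roots f. root_mult f p \<le> 2)"

lemma equiv_proj_rel: "equiv (UNIV - {(0, 0)}) proj_rel"
proof (rule equivI)
  show "proj_rel \<subseteq> (UNIV - {(0, 0)}) \<times> (UNIV - {(0, 0)})"
    by (auto simp: proj_rel_def)
  show "refl_on (UNIV - {(0, 0)}) proj_rel"
    by (auto simp: refl_on_def proj_rel_def intro!: exI[of _ 1])
  show "sym proj_rel"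
  proof (rule symI, clarify)
    fix a b a' b' assume "((a, b), (a', b')) \<in> proj_rel"
    then obtain c where "c \<noteq> 0" "a' = c * a" "b' = c * b" "(a, b) \<noteq> (0, 0)"
      by (auto simp: proj_rel_def)
    then show "((a', b'), (a, b)) \<in> proj_rel"
      by (auto simp: proj_rel_def intro!: exI[of _ "inverse c"])
  qed
  show "trans proj_rel"
  proof (rule transI, clarify)
    fix a b a' b' a'' b''
    assume "((a, b), (a', b')) \<in> proj_rel" "((a', b'), (a'', b'')) \<in> proj_rel"
    then obtain c d where "c \<noteq> 0" "a' = c * a" "b' = c * b" "(a, b) \<noteq> (0, 0)"
      "d \<noteq> 0" "a'' = d * a'" "b'' = d * b'"
      by (auto simp: proj_rel_def)
    then show "((a, b), (a'', b'')) \<in> proj_rel"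
      by (auto simp: proj_rel_def intro!: exI[of _ "d * c"])
  qed
qed

lemma root_mult_class:
  assumes "(a, b) \<noteq> (0, 0)"
  shows "root_mult f (proj_rel `` {(a, b)}) =
    multiplicity (scalar b * var_x - scalar a * var_y) f"
proof -
  let ?m = "\<lambda>(a, b). multiplicity (scalar b * var_x - scalar a * var_y) f"
  have "?m u = ?m (a, b)" if u: "u \<in> proj_rel `` {(a, b)}" for u
  proof -
    obtain c where c: "c \<noteq> 0" "u = (c * a, c * b)"
      using u by (auto simp: proj_rel_def)
    have "scalar (c * b) * var_x - scalar (c * a) * var_y
        = scalar c * (scalar b * var_x - scalar a * var_y)"
      by (simp add: scalar_def algebra_simps)
    moreover have "is_unit (scalar c)"
      using c by (intro dvdI[of _ _ "scalar (inverse c)"])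
      (simp add: scalar_def one_pCons)
    ultimately show ?thesis
      using c by (simp add: multiplicity_times_unit_left)
  qed
  moreover have "(a, b) \<in> proj_rel `` {(a, b)}"
    using equiv_class_self[OF equiv_proj_rel, of "(a, b)"] assms by simp
  ultimately have "?m ` (proj_rel `` {(a, b)}) = {?m (a, b)}"
    by (auto 0 3 intro!: image_eqI[of _ _ "(a, b)"])
  then show ?thesis by (simp add: root_mult_def)
qed

end

theory Submission
  imports Defs
begin

text \<open>
  The coefficients of a sextic \<open>f\<close>, divided by binomial coefficients, define a linear functional on
  polynomials of degree at most 6, and the sixth power of \<open>x + z y\<close> corresponds to evaluation
  at \<open>z\<close>. Hence (Sylvester) \<open>f\<close> is a sum of \<open>r\<close> powers as soon as the functional kills all multiples
  of a squarefree \<open>g\<close> of degree \<open>r\<close>, and conversely a sum of \<open>r\<close> powers is killed by the multiples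
  of some nonzero form of degree \<open>r\<close>.

  If no cubic annihilates \<open>f\<close>, the annihilating quartics contain a pencil without base points, whose
  general member is squarefree by a Wronskian argument, so the rank is 4. If the annihilating cubics
  form a line, then subtracting a general sixth power leads back to the first case, so the rank is at
  most 5. If they form a plane, then a quadric annihilates \<open>f\<close>, which forces rank 2 or a root of
  multiplicity at least 5. The refinements for double roots are obtained by moving them to
  \<open>[1 : 0]\<close>, \<open>[0 : 1]\<close> and \<open>[1 : 1]\<close>, where the annihilator equations can be solved explicitly.
\<close>

text \<open>Forms are handled as univariate polynomials with a nominal degree, so a root at [0 : 1]
  is a drop of degree. The two directions of Sylvester's criterion are not symmetric: an upper bound
  needs an annihilator that is squarefree and has full degree, a lower bound only that no nonzero
  annihilator exists. An annihilating cubic with a multiple root falls into the gap, and this is how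
  rank 5 arises. For x^6 + x y^5 the annihilating quartics are spanned by x^3 y and x^2 y^2, so all
  of them have a double root at [0 : 1]; the examples of rank 5 have the shape x^6 + y^5 l with l a
  linear form. The degree 6 = 2 * 3 makes the conditions on annihilating cubics a square Hankel
  system, the catalecticant. A root of f at [1 : 0] gives it leading zeros, and a double root makes
  it triangular; this is why roots are moved to standard positions.\<close>

subsection \<open>Binary forms and the apolar pairing\<close>

text \<open>The homogenization in the nominal degree d. A polynomial of degree less than d gets a
  root at [0 : 1], so a degree bound alone describes all forms of degree d.\<close>

definition hom :: "nat \<Rightarrow> complex poly \<Rightarrow> complex \<Rightarrow> complex \<Rightarrow> complex" where
  "hom d p x y = (\<Sum>k\<le>d. coeff p k * x ^ (d - k) * y ^ k)"

definition apolar :: "nat \<Rightarrow> complex poly \<Rightarrow> complex poly \<Rightarrow> complex" where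
  "apolar d P p = (\<Sum>k\<le>d. coeff P k / of_nat (d choose k) * coeff p k)"

text \<open>The degree n part of the apolar ideal of P. As in \<open>hom\<close>, n is nominal: a g
  of smaller degree stands for a dual form of degree n that vanishes at infinity.\<close>

definition annihilates :: "nat \<Rightarrow> complex poly \<Rightarrow> nat \<Rightarrow> complex poly \<Rightarrow> bool" where
  "annihilates d P n g \<longleftrightarrow> degree g \<le> n \<and> (\<forall>h. degree h \<le> d - n \<longrightarrow> apolar d P (g * h) = 0)"

definition waring_le :: "nat \<Rightarrow> nat \<Rightarrow> (complex \<Rightarrow> complex \<Rightarrow> complex) \<Rightarrow> bool" where
  "waring_le d r F \<longleftrightarrow> (\<exists>a b. \<forall>x y. F x y = (\<Sum>i<r. (a i * x + b i * y) ^ d))"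

lemma poly_eq_sum_atMost:
  fixes p :: "'a::{comm_semiring_0,semiring_1} poly"
  assumes "degree p \<le> d"
  shows "poly p x = (\<Sum>k\<le>d. coeff p k * x ^ k)"
proof -
  have "(\<Sum>k\<le>d. coeff p k * x ^ k) = (\<Sum>k\<le>degree p. coeff p k * x ^ k)"
    using assms by (intro sum.mono_neutral_right) (auto simp: coeff_eq_0)
  then show ?thesis using poly_altdef[of p x] by simp
qed

lemma hom_one_left: "degree p \<le> d \<Longrightarrow> hom d p 1 y = poly p y"
  by (simp add: hom_def poly_eq_sum_atMost)

lemma hom_nonzero_left:
  assumes "degree p \<le> d" "x \<noteq> 0"
  shows "hom d p x y = x ^ d * poly p (y / x)"
proof -
  have "coeff p k * x ^ (d - k) * y ^ k = x ^ d * (coeff p k * (y / x) ^ k)" if "k \<le> d" for k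
    using assms that by (simp add: power_divide power_diff)
  then show ?thesis
    unfolding hom_def poly_eq_sum_atMost[OF assms(1)] sum_distrib_left
    by (intro sum.cong) auto
qed

lemma hom_zero_left: "hom d p 0 y = coeff p d * y ^ d"
proof -
  have "hom d p 0 y = (\<Sum>k\<in>{d}. coeff p k * 0 ^ (d - k) * y ^ k)"
    unfolding hom_def by (rule sum.mono_neutral_right) auto
  then show ?thesis by simp
qed

text \<open>The case x = 0 of \<open>hom_mult\<close>: at infinity a form of nominal degree n is
  seen only through its coefficient n.\<close>

lemma coeff_mult_add_degree_bounds:
  fixes p q :: "'a::comm_semiring_0 poly"
  assumes "degree p \<le> n" "degree q \<le> m"
  shows "coeff (p * q) (n + m) = coeff p n * coeff q m"
proof -
  have "coeff (p * q) (n + m) = (\<Sum>i\<in>{n}. coeff p i * coeff q (n + m - i))"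
    unfolding coeff_mult
  proof (rule sum.mono_neutral_right)
    show "\<forall>i\<in>{..n + m} - {n}. coeff p i * coeff q (n + m - i) = 0"
    proof
      fix i assume "i \<in> {..n + m} - {n}"
      then have "i > n \<or> n + m - i > m" by auto
      then show "coeff p i * coeff q (n + m - i) = 0"
        using assms by (auto simp: coeff_eq_0)
    qed
  qed auto
  then show ?thesis by simp
qed

lemma hom_mult:
  assumes "degree p \<le> n" "degree q \<le> m"
  shows "hom (n + m) (p * q) x y = hom n p x y * hom m q x y"
proof (cases "x = 0")
  case True
  then show ?thesis
    by (simp add: hom_zero_left coeff_mult_add_degree_bounds[OF assms] power_add)
next
  case False
  have "degree (p * q) \<le> n + m"
    using degree_mult_le[of p q] assms by linarith
  then show ?thesis
    using False assms by (simp add: hom_nonzero_left power_add)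
qed

lemma hom_linear: "hom (Suc 0) [:a, b:] x y = a * x + b * y"
  by (simp add: hom_def)

lemma degree_power_linear_le: "degree ([:a, b:] ^ n) \<le> n"
  for a b :: "'a::comm_semiring_1"
  by (rule order.trans[OF degree_power_le]) simp

lemma hom_power_linear: "hom n ([:a, b:] ^ n) x y = (a * x + b * y) ^ n"
proof (induction n)
  case 0
  then show ?case by (simp add: hom_def)
next
  case (Suc n)
  have "hom (Suc 0 + n) ([:a, b:] * [:a, b:] ^ n) x y
      = hom (Suc 0) [:a, b:] x y * hom n ([:a, b:] ^ n) x y"
    by (rule hom_mult) (auto simp: degree_power_linear_le)
  then show ?case by (simp only: Suc.IH hom_linear power_Suc add_Suc add_0)
qed

lemma hom_add: "hom d (p + q) x y = hom d p x y + hom d q x y"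
  by (simp add: hom_def sum.distrib algebra_simps)

lemma hom_smult: "hom d (smult c p) x y = c * hom d p x y"
  by (simp add: hom_def sum_distrib_left mult.assoc)

lemma hom_diff: "hom d (p - q) x y = hom d p x y - hom d q x y"
  by (simp add: hom_def sum_subtractf algebra_simps)

lemma hom_0: "hom d 0 x y = 0"
  by (simp add: hom_def)

lemma hom_sum: "hom d (\<Sum>i\<in>I. p i) x y = (\<Sum>i\<in>I. hom d (p i) x y)"
  by (induction I rule: infinite_finite_induct) (simp_all add: hom_0 hom_add)

lemma hom_monom: "k \<le> d \<Longrightarrow> hom d (monom c k) x y = c * x ^ (d - k) * y ^ k"
proof -
  assume "k \<le> d"
  then have "hom d (monom c k) x y = (\<Sum>j\<in>{k}. coeff (monom c k) j * x ^ (d - j) * y ^ j)"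
    unfolding hom_def by (intro sum.mono_neutral_right) auto
  then show ?thesis by simp
qed

lemma hom_subst_linear:
  obtains Q where "degree Q \<le> d"
    "\<And>x y. hom d P (a * x + a' * y) (b * x + b' * y) = hom d Q x y"
proof
  let ?q = "\<lambda>k. smult (coeff P k) ([:a, a':] ^ (d - k) * [:b, b':] ^ k)"
  have deg: "degree (?q k) \<le> d" if "k \<le> d" for k
  proof -
    have "degree ([:a, a':] ^ (d - k) * [:b, b':] ^ k) \<le> (d - k) + k"
      by (rule order.trans[OF degree_mult_le])
        (intro add_mono degree_power_linear_le)
    then show ?thesis using that by (simp add: degree_smult_le order.trans)
  qed
  show "degree (\<Sum>k\<le>d. ?q k) \<le> d"
    using deg by (intro degree_sum_le) auto
  fix x y
  have "hom d ([:a, a':] ^ (d - k) * [:b, b':] ^ k) x y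
      = (a * x + a' * y) ^ (d - k) * (b * x + b' * y) ^ k" if "k \<le> d" for k
    using hom_mult[OF degree_power_linear_le degree_power_linear_le,
        of "d - k" k a a' b b' x y] that
    by (simp add: hom_power_linear)
  then show "hom d P (a * x + a' * y) (b * x + b' * y) = hom d (\<Sum>k\<le>d. ?q k) x y"
    by (simp add: hom_sum hom_smult hom_def[of d P] mult.assoc)
qed

section \<open>The apolar pairing as a functional\<close>

lemma apolar_add: "apolar d P (p + q) = apolar d P p + apolar d P q"
  unfolding apolar_def sum.distrib[symmetric] by (simp add: distrib_left)

lemma apolar_smult: "apolar d P (smult c p) = c * apolar d P p"
  by (simp add: apolar_def sum_distrib_left mult_ac)

lemma apolar_diff: "apolar d P (p - q) = apolar d P p - apolar d P q"
  unfolding apolar_def sum_subtractf[symmetric] by (simp add: right_diff_distrib)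

lemma apolar_0: "apolar d P 0 = 0"
  by (simp add: apolar_def)

lemma apolar_sum: "apolar d P (\<Sum>i\<in>I. p i) = (\<Sum>i\<in>I. apolar d P (p i))"
  by (induction I rule: infinite_finite_induct) (simp_all add: apolar_0 apolar_add)

lemma apolar_diff_left: "apolar d (P - Q) p = apolar d P p - apolar d Q p"
  unfolding apolar_def sum_subtractf[symmetric] by (simp add: diff_divide_distrib left_diff_distrib)

lemma apolar_monom: "k \<le> d \<Longrightarrow> apolar d P (monom c k) = c * coeff P k / of_nat (d choose k)"
proof -
  assume "k \<le> d"
  then have "apolar d P (monom c k)
      = (\<Sum>j\<in>{k}. coeff P j / of_nat (d choose j) * coeff (monom c k) j)"
    unfolding apolar_def by (intro sum.mono_neutral_right) auto
  then show ?thesis by simp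
qed

lemma poly_eq_sum_monom:
  assumes "degree p \<le> n"
  shows "p = (\<Sum>k\<le>n. monom (coeff p k) k)"
  using poly_as_sum_of_monoms'[OF assms] by simp

text \<open>Monomials span the test polynomials h, so the condition becomes a Hankel linear system
  in the coefficients of P divided by binomials.\<close>

lemma annihilates_iff:
  assumes "n \<le> d"
  shows "annihilates d P n g \<longleftrightarrow> degree g \<le> n \<and>
    (\<forall>j\<le>d - n. (\<Sum>k\<le>n. coeff g k * (coeff P (k + j) / of_nat (d choose (k + j)))) = 0)"
proof (cases "degree g \<le> n")
  case True
  have eq: "apolar d P (g * monom c j)
      = c * (\<Sum>k\<le>n. coeff g k * (coeff P (k + j) / of_nat (d choose (k + j))))"
    if "j \<le> d - n" for j c
  proof -
    have "g * monom c j = (\<Sum>k\<le>n. monom (coeff g k) k) * monom c j"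
      using poly_eq_sum_monom[OF True] by simp
    also have "\<dots> = (\<Sum>k\<le>n. monom (c * coeff g k) (k + j))"
      unfolding sum_distrib_right by (simp add: mult_monom mult.commute add.commute)
    finally have "apolar d P (g * monom c j) = (\<Sum>k\<le>n. apolar d P (monom (c * coeff g k) (k + j)))"
      by (simp add: apolar_sum)
    also have "\<dots> = (\<Sum>k\<le>n. c * coeff g k * coeff P (k + j) / of_nat (d choose (k + j)))"
      using that assms by (intro sum.cong) (auto simp: apolar_monom)
    finally show ?thesis by (simp add: sum_distrib_left mult.assoc)
  qed
  have "(\<forall>h. degree h \<le> d - n \<longrightarrow> apolar d P (g * h) = 0) \<longleftrightarrow>
      (\<forall>j\<le>d - n. (\<Sum>k\<le>n. coeff g k * (coeff P (k + j) / of_nat (d choose (k + j)))) = 0)"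
    (is "?L \<longleftrightarrow> ?R")
  proof
    assume L: ?L
    show ?R
    proof (intro allI impI)
      fix j assume j: "j \<le> d - n"
      have "apolar d P (g * monom 1 j) = 0"
        using L order.trans[OF degree_monom_le j] by blast
      then show "(\<Sum>k\<le>n. coeff g k * (coeff P (k + j) / of_nat (d choose (k + j)))) = 0"
        using eq[OF j, of 1] by simp
    qed
  next
    assume R: ?R
    show ?L
    proof (intro allI impI)
      fix h :: "complex poly" assume h: "degree h \<le> d - n"
      have "g * h = (\<Sum>j\<le>d - n. g * monom (coeff h j) j)"
        by (subst poly_eq_sum_monom[OF h]) (rule sum_distrib_left)
      then show "apolar d P (g * h) = 0"
        using R eq by (simp add: apolar_sum)
    qed
  qed
  then show ?thesis using True by (simp add: annihilates_def)
qed (simp add: annihilates_def)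

lemma coeff_eq_of_power_sum:
  assumes "\<And>x y. hom d P x y = (\<Sum>i\<in>I. c i * (a i * x + b i * y) ^ d)" and "k \<le> d"
  shows "coeff P k = of_nat (d choose k) * (\<Sum>i\<in>I. c i * a i ^ (d - k) * b i ^ k)"
proof -
  have "(\<Sum>k\<le>d. coeff P k * y ^ k)
      = (\<Sum>k\<le>d. (of_nat (d choose k) * (\<Sum>i\<in>I. c i * a i ^ (d - k) * b i ^ k)) * y ^ k)" for y
  proof -
    have "(a i + b i * y) ^ d = (\<Sum>k\<le>d. of_nat (d choose k) * a i ^ (d - k) * b i ^ k * y ^ k)" for i
      using binomial_ring[of "b i * y" "a i" d]
      by (simp add: power_mult_distrib mult_ac add.commute)
    then have "(\<Sum>i\<in>I. c i * (a i + b i * y) ^ d)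
      = (\<Sum>k\<le>d. \<Sum>i\<in>I. c i * (of_nat (d choose k) * a i ^ (d - k) * b i ^ k * y ^ k))"
      by (simp only: sum_distrib_left) (rule sum.swap)
    also have "\<dots> = (\<Sum>k\<le>d. (of_nat (d choose k) * (\<Sum>i\<in>I. c i * a i ^ (d - k) * b i ^ k)) * y ^ k)"
      by (simp add: sum_distrib_left sum_distrib_right mult_ac)
    finally have "hom d P 1 y = \<dots>" using assms(1)[of 1 y] by (simp only: mult_1_right)
    then show ?thesis by (simp only: hom_def power_one mult_1_right)
  qed
  then have "\<forall>k\<le>d. coeff P k = of_nat (d choose k) * (\<Sum>i\<in>I. c i * a i ^ (d - k) * b i ^ k)"
    by (intro iffD1[OF polyfun_eq_coeffs] allI)
  then show ?thesis using assms(2) by simp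
qed

text \<open>Each power contributes an evaluation at its point (a i, b i). Evaluating
  \<open>hom d p\<close> rather than \<open>poly p\<close> also covers the points with a i =
  0.\<close>

lemma apolar_power_sum:
  assumes "\<And>x y. hom d P x y = (\<Sum>i\<in>I. c i * (a i * x + b i * y) ^ d)"
  shows "apolar d P p = (\<Sum>i\<in>I. c i * hom d p (a i) (b i))"
proof -
  have "apolar d P p = (\<Sum>k\<le>d. (\<Sum>i\<in>I. c i * a i ^ (d - k) * b i ^ k) * coeff p k)"
    unfolding apolar_def
    by (intro sum.cong refl) (simp add: coeff_eq_of_power_sum[OF assms])
  also have "\<dots> = (\<Sum>k\<le>d. \<Sum>i\<in>I. c i * (coeff p k * a i ^ (d - k) * b i ^ k))"
    by (simp add: sum_distrib_left sum_distrib_right mult_ac)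
  also have "\<dots> = (\<Sum>i\<in>I. c i * hom d p (a i) (b i))"
    unfolding hom_def sum_distrib_left by (rule sum.swap)
  finally show ?thesis .
qed

text \<open>The moments on the monomials up to d determine every coefficient that
  \<open>hom d P\<close> uses; the binomial theorem reassembles the powers.\<close>

lemma power_sum_of_apolar:
  assumes "\<And>k. k \<le> d \<Longrightarrow> apolar d P (monom 1 k) = (\<Sum>i\<in>I. c i * a i ^ (d - k) * b i ^ k)"
  shows "hom d P x y = (\<Sum>i\<in>I. c i * (a i * x + b i * y) ^ d)"
proof -
  have "hom d P x y = (\<Sum>k\<le>d. of_nat (d choose k) * (\<Sum>i\<in>I. c i * a i ^ (d - k) * b i ^ k) * x ^ (d - k) * y ^ k)"
    unfolding hom_def
  proof (intro sum.cong refl)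
    fix k assume "k \<in> {..d}"
    then show "coeff P k * x ^ (d - k) * y ^ k
        = of_nat (d choose k) * (\<Sum>i\<in>I. c i * a i ^ (d - k) * b i ^ k) * x ^ (d - k) * y ^ k"
      using assms[of k] by (simp add: apolar_monom nonzero_divide_eq_eq mult.commute)
  qed
  also have "\<dots> = (\<Sum>k\<le>d. \<Sum>i\<in>I. c i * (of_nat (d choose k) * (b i * y) ^ k * (a i * x) ^ (d - k)))"
    by (simp add: sum_distrib_left sum_distrib_right power_mult_distrib mult_ac)
  also have "\<dots> = (\<Sum>i\<in>I. c i * (b i * y + a i * x) ^ d)"
    unfolding binomial_ring sum_distrib_left by (rule sum.swap)
  finally show ?thesis by (simp add: add.commute)
qed

section \<open>Weights, padding and coordinate changes for sums of powers\<close>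

lemma waring_le_of_power_sum:
  assumes "d > 0" "finite I" "card I \<le> r"
    and "\<And>x y. F x y = (\<Sum>i\<in>I. c i * (a i * x + b i * y) ^ d)"
  shows "waring_le d r F"
proof -
  obtain e where e: "bij_betw e {..<card I} I"
    using ex_bij_betw_nat_finite[OF assms(2)] by (auto simp: lessThan_atLeast0)
  \<comment> \<open>Over the complex numbers every weight is a d-th power and is absorbed into its
    linear form.\<close>
  have "\<forall>i. \<exists>z. z ^ d = c i" using nth_root_exists[OF assms(1)] by blast
  then obtain z where z: "\<And>i. z i ^ d = c i" by metis
  \<comment> \<open>Indices from card I up to r receive the zero form, whose d-th power vanishes
    because d > 0.\<close>
  let ?a = "\<lambda>i. if i < card I then z (e i) * a (e i) else 0"
  let ?b = "\<lambda>i. if i < card I then z (e i) * b (e i) else 0"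
  have "F x y = (\<Sum>i<r. (?a i * x + ?b i * y) ^ d)" for x y
  proof -
    have "F x y = (\<Sum>i<card I. c (e i) * (a (e i) * x + b (e i) * y) ^ d)"
      unfolding assms(4) using sum.reindex_bij_betw[OF e, of "\<lambda>i. c i * (a i * x + b i * y) ^ d"]
      by simp
    also have "\<dots> = (\<Sum>i<card I. (?a i * x + ?b i * y) ^ d)"
      by (intro sum.cong) (simp_all add: z[symmetric] power_mult_distrib[symmetric] algebra_simps)
    also have "\<dots> = (\<Sum>i<r. (?a i * x + ?b i * y) ^ d)"
      using assms(1,3) by (intro sum.mono_neutral_left) auto
    finally show ?thesis .
  qed
  then show ?thesis
    unfolding waring_le_def by (intro exI[of _ ?a] exI[of _ ?b]) blast
qed

lemma waring_le_mono:
  assumes "waring_le d r F" "r \<le> r'" "d > 0"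
  shows "waring_le d r' F"
proof -
  obtain a b where "\<And>x y. F x y = (\<Sum>i<r. 1 * (a i * x + b i * y) ^ d)"
    using assms(1) by (auto simp: waring_le_def)
  with assms(2,3) show ?thesis
    by (intro waring_le_of_power_sum[of d "{..<r}" r' F "\<lambda>_. 1" a b]) auto
qed

lemma waring_le_add_power:
  assumes "waring_le d r (\<lambda>x y. F x y - c * (a * x + b * y) ^ d)" "d > 0"
  shows "waring_le d (Suc r) F"
proof -
  obtain a' b' where *: "\<And>x y. F x y - c * (a * x + b * y) ^ d = (\<Sum>i<r. (a' i * x + b' i * y) ^ d)"
    using assms(1) unfolding waring_le_def by blast
  let ?c = "(\<lambda>_. 1)(r := c)" and ?a = "a'(r := a)" and ?b = "b'(r := b)"
  have "F x y = (\<Sum>i<Suc r. ?c i * (?a i * x + ?b i * y) ^ d)" for x y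
    using *[of x y] by (simp add: algebra_simps)
  with assms(2) show ?thesis
    by (intro waring_le_of_power_sum[of d "{..<Suc r}" "Suc r" F ?c ?a ?b]) auto
qed

lemma waring_le_subst:
  assumes "waring_le d r F"
  shows "waring_le d r (\<lambda>x y. F (a * x + a' * y) (b * x + b' * y))"
proof -
  obtain p q where *: "\<And>x y. F x y = (\<Sum>i<r. (p i * x + q i * y) ^ d)"
    using assms unfolding waring_le_def by blast
  have "F (a * x + a' * y) (b * x + b' * y)
    = (\<Sum>i<r. ((p i * a + q i * b) * x + (p i * a' + q i * b') * y) ^ d)" for x y
    unfolding * by (intro sum.cong) (simp_all add: algebra_simps)
  then show ?thesis
    unfolding waring_le_def
    by (intro exI[of _ "\<lambda>i. p i * a + q i * b"] exI[of _ "\<lambda>i. p i * a' + q i * b'"]) blast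
qed

lemma waring_le_subst_iff:
  assumes "a * b' \<noteq> a' * b"
  shows "waring_le d r (\<lambda>x y. F (a * x + a' * y) (b * x + b' * y)) \<longleftrightarrow> waring_le d r F"
proof
  let ?D = "a * b' - a' * b"
  assume "waring_le d r (\<lambda>x y. F (a * x + a' * y) (b * x + b' * y))"
  from waring_le_subst[OF this, of "b' / ?D" "- a' / ?D" "- b / ?D" "a / ?D"]
  have "waring_le d r (\<lambda>x y. F
      (a * (b' / ?D * x + - a' / ?D * y) + a' * (- b / ?D * x + a / ?D * y))
      (b * (b' / ?D * x + - a' / ?D * y) + b' * (- b / ?D * x + a / ?D * y)))"
    by simp
  moreover have "a * (b' / ?D * x + - a' / ?D * y) + a' * (- b / ?D * x + a / ?D * y) = x"
    "b * (b' / ?D * x + - a' / ?D * y) + b' * (- b / ?D * x + a / ?D * y) = y" for x y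
    using assms by (simp_all add: divide_simps) (simp_all add: algebra_simps)
  ultimately show "waring_le d r F" by simp
qed (rule waring_le_subst)

subsection \<open>Annihilators and Waring rank\<close>

text \<open>Gaussian elimination by induction on the equations: an equation either is trivial or
  eliminates one unknown, which costs one of each.\<close>

lemma homogeneous_system_nontrivial:
  fixes c :: "'i \<Rightarrow> 'j \<Rightarrow> 'a::field"
  assumes "finite I" "finite J" "card I < card J"
  shows "\<exists>v. (\<exists>j\<in>J. v j \<noteq> 0) \<and> (\<forall>i\<in>I. (\<Sum>j\<in>J. c i j * v j) = 0)"
  using assms
proof (induction I arbitrary: J c rule: finite_induct)
  case empty
  then have "J \<noteq> {}" by auto
  then show ?case by (intro exI[of _ "\<lambda>_. 1"]) auto
next
  case (insert i I)
  show ?case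
  proof (cases "\<forall>j\<in>J. c i j = 0")
    case True
    then show ?thesis using insert.IH[of J c] insert.prems insert.hyps by auto
  next
    case False
    then obtain k where k: "k \<in> J" "c i k \<noteq> 0" by auto
    let ?c = "\<lambda>i' j. c i' j - c i' k * c i j / c i k"
    have "card I < card (J - {k})"
      using insert k by simp
    then obtain v where v: "\<exists>j\<in>J - {k}. v j \<noteq> 0"
      "\<And>i'. i' \<in> I \<Longrightarrow> (\<Sum>j\<in>J - {k}. ?c i' j * v j) = 0"
      using insert.IH[of "J - {k}" ?c] insert.prems by blast
    define s where "s = (\<Sum>j\<in>J - {k}. c i j * v j)"
    define w where "w = v(k := - s / c i k)"
    have sum_w: "(\<Sum>j\<in>J. c i' j * w j) = (\<Sum>j\<in>J - {k}. c i' j * v j) - c i' k * s / c i k" for i'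
    proof -
      have "(\<Sum>j\<in>J. c i' j * w j) = c i' k * w k + (\<Sum>j\<in>J - {k}. c i' j * w j)"
        using k insert.prems by (simp add: sum.remove)
      moreover have "(\<Sum>j\<in>J - {k}. c i' j * w j) = (\<Sum>j\<in>J - {k}. c i' j * v j)"
        by (intro sum.cong) (auto simp: w_def)
      ultimately show ?thesis by (simp add: w_def)
    qed
    have "(\<Sum>j\<in>J. c i' j * w j) = 0" if "i' \<in> I" for i'
    proof -
      have "c i' k * s / c i k = (\<Sum>j\<in>J - {k}. c i' k * c i j / c i k * v j)"
        by (simp add: s_def sum_distrib_left sum_divide_distrib mult.assoc)
      then have "(\<Sum>j\<in>J. c i' j * w j) = (\<Sum>j\<in>J - {k}. ?c i' j * v j)"
        unfolding sum_w by (simp add: sum_subtractf left_diff_distrib)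
      then show ?thesis using v(2)[OF that] by simp
    qed
    moreover have "(\<Sum>j\<in>J. c i j * w j) = 0"
      unfolding sum_w using k by (simp add: s_def)
    moreover have "\<exists>j\<in>J. w j \<noteq> 0"
      using v(1) by (auto simp: w_def)
    ultimately show ?thesis by blast
  qed
qed

lemma annihilates_smult: "annihilates d P n g \<Longrightarrow> annihilates d P n (smult c g)"
  by (auto simp: annihilates_def apolar_smult intro: order.trans[OF degree_smult_le])

lemma annihilates_diff:
  "annihilates d P n g \<Longrightarrow> annihilates d P n h \<Longrightarrow> annihilates d P n (g - h)"
  by (auto simp: annihilates_def apolar_diff left_diff_distrib intro: degree_diff_le)

lemma annihilates_add:
  "annihilates d P n g \<Longrightarrow> annihilates d P n h \<Longrightarrow> annihilates d P n (g + h)"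
  by (auto simp: annihilates_def apolar_add distrib_right intro: degree_add_le)

text \<open>There are d - n + 1 equations in the n + 1 - card I free coefficients; the last
  assumption says that the unknowns outnumber the equations. Prescribing zeros at I later yields a
  second annihilator independent of a given one.\<close>

lemma annihilator_exists:
  assumes "n \<le> d" "I \<subseteq> {..n}" "card I + d < 2 * n"
  obtains g where "g \<noteq> 0" "annihilates d P n g" "\<And>i. i \<in> I \<Longrightarrow> coeff g i = 0"
proof -
  let ?c = "\<lambda>j k. coeff P (k + j) / of_nat (d choose (k + j))"
  have "card ({..n} - I) = Suc n - card I"
    using assms(2) by (subst card_Diff_subset) (auto intro: finite_subset)
  then have "card {..d - n} < card ({..n} - I)"
    using assms by simp
  from homogeneous_system_nontrivial[OF _ _ this, of ?c]
  obtain v where v: "\<exists>k\<in>{..n} - I. v k \<noteq> 0"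
    "\<And>j. j \<le> d - n \<Longrightarrow> (\<Sum>k\<in>{..n} - I. ?c j k * v k) = 0"
    by auto
  define g where "g = (\<Sum>k\<in>{..n} - I. monom (v k) k)"
  have coeff_g: "coeff g k = (if k \<in> {..n} - I then v k else 0)" for k
    by (simp add: g_def coeff_sum sum.delta' cong: if_cong)
  show ?thesis
  proof
    show "g \<noteq> 0" using v(1) coeff_g by (metis coeff_0)
    show "coeff g i = 0" if "i \<in> I" for i using that by (simp add: coeff_g)
    have "degree g \<le> n" by (intro degree_le) (auto simp: coeff_g)
    moreover have "(\<Sum>k\<le>n. coeff g k * ?c j k) = 0" if "j \<le> d - n" for j
    proof -
      have "(\<Sum>k\<le>n. coeff g k * ?c j k) = (\<Sum>k\<in>{..n} - I. ?c j k * v k)"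
        by (intro sum.mono_neutral_cong_right) (auto simp: coeff_g)
      then show ?thesis using v(2)[OF that] by simp
    qed
    ultimately show "annihilates d P n g"
      using assms(1) by (simp add: annihilates_iff)
  qed
qed

lemma waring_le_imp_annihilator:
  assumes "waring_le d r (hom d P)" "r \<le> d" "d > 0"
  obtains g where "g \<noteq> 0" "annihilates d P r g"
proof -
  obtain a b where ab: "\<And>x y. hom d P x y = (\<Sum>i<r. 1 * (a i * x + b i * y) ^ d)"
    using assms(1) by (auto simp: waring_le_def)
  \<comment> \<open>The form - b i x + a i y vanishes at (a i, b i). A zero summand gets the factor
    1 so that the product stays nonzero; a i = 0 gives a nonzero constant, that is, a linear form
    with its root at infinity.\<close>
  define L where "L = (\<lambda>i. if a i = 0 \<and> b i = 0 then 1 else [:- b i, a i:])"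
  define g where "g = (\<Prod>i<r. L i)"
  have deg_L: "degree (L i) \<le> 1" for i by (simp add: L_def)
  have deg: "degree (\<Prod>i\<in>I. L i) \<le> card I" if "finite I" for I
    using degree_prod_sum_le[OF that, of L] sum_bounded_above[of I "\<lambda>i. degree (L i)" 1] deg_L
    by force
  show ?thesis
  proof
    show "g \<noteq> 0" by (auto simp: g_def L_def)
    have deg_g: "degree g \<le> r" using deg[of "{..<r}"] by (simp add: g_def)
    moreover have "apolar d P (g * h) = 0" if h: "degree h \<le> d - r" for h
    proof -
      have "hom d (g * h) (a i) (b i) = 0" if i: "i < r" for i
      proof (cases "a i = 0 \<and> b i = 0")
        case True
        then show ?thesis using assms(3) by (simp add: hom_zero_left)
      next
        case False
        have "hom d (g * h) (a i) (b i) = hom r g (a i) (b i) * hom (d - r) h (a i) (b i)"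
          using hom_mult[OF deg_g h] assms(2) by simp
        moreover have "g = L i * (\<Prod>j\<in>{..<r} - {i}. L j)"
          unfolding g_def using i by (simp add: prod.remove)
        moreover have "hom (Suc 0 + (r - 1)) (L i * (\<Prod>j\<in>{..<r} - {i}. L j)) (a i) (b i)
            = hom (Suc 0) (L i) (a i) (b i) * hom (r - 1) (\<Prod>j\<in>{..<r} - {i}. L j) (a i) (b i)"
          using deg_L[of i] deg[of "{..<r} - {i}"] i by (intro hom_mult) simp_all
        moreover have "hom (Suc 0) (L i) (a i) (b i) = 0"
          using False by (simp add: L_def hom_def)
        ultimately show ?thesis using i by simp
      qed
      then show ?thesis by (simp add: apolar_power_sum[OF ab])
    qed
    ultimately show "annihilates d P r g" by (simp add: annihilates_def)
  qed
qed

lemma prod_linear_dvd: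
  fixes q :: "'a::idom poly"
  assumes "finite Z" "\<And>z. z \<in> Z \<Longrightarrow> poly q z = 0"
  shows "(\<Prod>z\<in>Z. [:- z, 1:]) dvd q"
  using assms
proof (induction Z rule: finite_induct)
  case (insert z Z)
  then obtain k where k: "q = (\<Prod>z\<in>Z. [:- z, 1:]) * k" by (auto elim: dvdE)
  have "poly (\<Prod>z\<in>Z. [:- z, 1:]) z \<noteq> 0"
    using insert.hyps by (auto simp: poly_prod)
  then have "poly k z = 0" using insert.prems[of z] k by simp
  then have "[:- z, 1:] dvd k" by (simp add: poly_eq_0_iff_dvd)
  then show ?case using insert.hyps k by (simp add: mult.commute mult_dvd_mono del: mult_pCons_left mult_pCons_right)
qed simp

lemma degree_prod_linear: "degree (\<Prod>z\<in>Z. [:- z, 1::'a::idom:]) = card Z"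
  by (cases "finite Z") (simp_all add: degree_prod_sum_eq)

text \<open>
  A functional that kills all multiples of \<open>g\<close> depends only on the values at the roots of \<open>g\<close>;
  by Lagrange interpolation it is a combination of point evaluations, and evaluation at \<open>z\<close>
  is the functional of the power \<open>(x + z y)\<^sup>d\<close>.
\<close>

lemma waring_le_of_annihilator:
  assumes "finite Z" "card Z \<le> d" "d > 0"
    and ann: "annihilates d P (card Z) (\<Prod>z\<in>Z. [:- z, 1:])"
  shows "waring_le d (card Z) (hom d P)"
proof -
  define M where "M = (\<lambda>z. \<Prod>w\<in>Z - {z}. [:- w, 1::complex:])"
  define L where "L = (\<lambda>z. smult (inverse (poly (M z) z)) (M z))"
  have M_nz: "poly (M z) z \<noteq> 0" for z
    using assms(1) by (auto simp: M_def poly_prod)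
  have L_val: "poly (L z) w = (if w = z then 1 else 0)" if "z \<in> Z" "w \<in> Z" for z w
    using M_nz[of z] that assms(1) by (auto simp: L_def M_def poly_prod)
  have deg_L: "degree (L z) \<le> d" if "z \<in> Z" for z
  proof -
    have "degree (L z) \<le> card (Z - {z})"
      unfolding L_def M_def degree_prod_linear[symmetric] by (rule degree_smult_le)
    then show ?thesis using assms(1,2) card_mono[of Z "Z - {z}"] by fastforce
  qed
  have eval: "apolar d P p = (\<Sum>z\<in>Z. poly p z * apolar d P (L z))" if p: "degree p \<le> d" for p
  proof -
    \<comment> \<open>The interpolation error vanishes on Z, hence is a multiple of the annihilator.
      The bound on its degree limits the cofactor to degree d - card Z, as
      \<open>annihilates\<close> demands.\<close>
    define q where "q = p - (\<Sum>z\<in>Z. smult (poly p z) (L z))"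
    have deg_q: "degree q \<le> d"
      unfolding q_def using p deg_L assms(1)
      by (intro degree_diff_le degree_sum_le) (auto intro: order.trans[OF degree_smult_le])
    have "poly q w = 0" if w: "w \<in> Z" for w
    proof -
      have "(\<Sum>z\<in>Z. poly p z * poly (L z) w) = (\<Sum>z\<in>Z. if w = z then poly p z else 0)"
        using w by (intro sum.cong) (auto simp: L_val)
      then show ?thesis using w assms(1) by (simp add: q_def poly_sum)
    qed
    then obtain k where k: "q = (\<Prod>z\<in>Z. [:- z, 1:]) * k"
      using prod_linear_dvd[OF assms(1)] by (metis dvdE)
    have "apolar d P q = 0"
    proof (cases "k = 0")
      case False
      have "(\<Prod>z\<in>Z. [:- z, 1::complex:]) \<noteq> 0" using assms(1) by auto
      then have "degree q = card Z + degree k"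
        unfolding k using False by (subst degree_mult_eq) (auto simp: degree_prod_linear)
      then show ?thesis using ann deg_q by (simp add: annihilates_def k)
    qed (simp add: k apolar_0)
    then show ?thesis
      by (simp add: q_def apolar_diff apolar_sum apolar_smult)
  qed
  have "hom d P x y = (\<Sum>z\<in>Z. apolar d P (L z) * (1 * x + z * y) ^ d)" for x y
  proof (rule power_sum_of_apolar)
    fix k assume "k \<le> d"
    then show "apolar d P (monom 1 k) = (\<Sum>z\<in>Z. apolar d P (L z) * 1 ^ (d - k) * z ^ k)"
      by (subst eval) (auto simp: degree_monom_eq poly_monom mult.commute)
  qed
  with assms show ?thesis
    by (intro waring_le_of_power_sum[of d Z _ _ "\<lambda>z. apolar d P (L z)" "\<lambda>_. 1" "\<lambda>z. z"]) auto
qed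

lemma card_roots_rsquarefree:
  fixes g :: "complex poly"
  assumes "rsquarefree g"
  shows "card {z. poly g z = 0} = degree g"
  using arg_cong[OF complex_poly_decompose_rsquarefree[OF assms], of degree] assms
  unfolding degree_smult_eq degree_prod_linear by (simp add: rsquarefree_def)

text \<open>Degree exactly r excludes a root at infinity, so g has r distinct affine roots and is a
  scalar multiple of the product of their linear factors.\<close>

lemma waring_le_of_rsquarefree_annihilator:
  assumes "rsquarefree g" "degree g = r" "r \<le> d" "d > 0" "annihilates d P r g"
  shows "waring_le d r (hom d P)"
proof -
  let ?Z = "{z. poly g z = 0}"
  have g: "g \<noteq> 0" using assms(1) by (simp add: rsquarefree_def)
  have fin: "finite ?Z" using g by (rule poly_roots_finite)
  have dec: "smult (lead_coeff g) (\<Prod>z\<in>?Z. [:- z, 1:]) = g"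
    by (rule complex_poly_decompose_rsquarefree[OF assms(1)])
  have card: "card ?Z = r" using card_roots_rsquarefree[OF assms(1)] assms(2) by simp
  have "smult (inverse (lead_coeff g)) g = (\<Prod>z\<in>?Z. [:- z, 1:])"
    using g by (subst dec[symmetric]) simp
  then have "annihilates d P (card ?Z) (\<Prod>z\<in>?Z. [:- z, 1:])"
    using annihilates_smult[OF assms(5), of "inverse (lead_coeff g)"] card by simp
  from waring_le_of_annihilator[OF fin _ assms(4) this] show ?thesis
    using assms(3) card by simp
qed

section \<open>Pencils of annihilators without base points\<close>

lemma wronskian_nonzero:
  fixes p q :: "complex poly"
  assumes "\<And>z. \<not> (poly p z = 0 \<and> poly q z = 0)" "degree q > 0"
  shows "p * pderiv q - pderiv p * q \<noteq> 0"
proof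
  assume "p * pderiv q - pderiv p * q = 0"
  then have eq: "p * pderiv q = pderiv p * q" by simp
  have "\<not> constant (poly q)" using assms(2) by (simp add: constant_degree)
  then obtain z where z: "poly q z = 0" using fundamental_theorem_of_algebra by blast
  then have pz: "poly p z \<noteq> 0" using assms(1) by blast
  have q: "q \<noteq> 0" and q': "pderiv q \<noteq> 0" using assms(2) by (auto simp: pderiv_eq_0_iff)
  have nz: "p * pderiv q \<noteq> 0" using pz q' by auto
  \<comment> \<open>At z the product p * pderiv q has order one less than q, since p z is nonzero,
    whereas pderiv p * q has at least the order of q.\<close>
  have "order z q = Suc (order z (pderiv q))" using order_pderiv[OF q z] .
  moreover have "order z (p * pderiv q) = order z (pderiv q)"
    using nz pz by (simp add: order_mult order_0I)
  moreover have "order z (pderiv p * q) \<ge> order z q"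
    using nz eq by (simp add: order_mult)
  ultimately show False using eq by simp
qed

text \<open>
  A multiple root \<open>u\<close> of \<open>p + t q\<close> is a root of the Wronskian and determines \<open>t\<close>, so only
  finitely many \<open>t\<close> are bad.
\<close>

lemma pencil_rsquarefree:
  fixes p q :: "complex poly"
  assumes "\<And>z. \<not> (poly p z = 0 \<and> poly q z = 0)" "degree p \<le> n" "degree q = n" "n > 0"
  obtains t where "rsquarefree (p + smult t q)" "degree (p + smult t q) = n"
proof -
  define W where "W = p * pderiv q - pderiv p * q"
  have "W \<noteq> 0" unfolding W_def using assms by (intro wronskian_nonzero) auto
  \<comment> \<open>The additional excluded value is the one at which the coefficient in degree n
    cancels, which would be a root at infinity.\<close>
  then have "finite ((\<lambda>u. - poly p u / poly q u) ` {u. poly W u = 0} \<union> {- coeff p n / coeff q n})"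
    by (auto intro: poly_roots_finite)
  then obtain t where t: "t \<notin> (\<lambda>u. - poly p u / poly q u) ` {u. poly W u = 0} \<union> {- coeff p n / coeff q n}"
    using ex_new_if_finite[OF infinite_UNIV_char_0] by blast
  have qn: "coeff q n \<noteq> 0" using assms(3,4) by (metis degree_0 leading_coeff_0_iff less_irrefl)
  show ?thesis
  proof
    have "coeff p n + t * coeff q n \<noteq> 0"
    proof
      assume "coeff p n + t * coeff q n = 0"
      then have "t * coeff q n = - coeff p n"
        by (simp add: eq_neg_iff_add_eq_0 add.commute)
      then have "t = - coeff p n / coeff q n"
        by (rule nonzero_eq_divide_eq[OF qn, THEN iffD2])
      then show False using t by simp
    qed
    then have "n \<le> degree (p + smult t q)" by (intro le_degree) simp
    moreover have "degree (p + smult t q) \<le> n"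
      using assms(2,3) by (intro degree_add_le) (auto intro: order.trans[OF degree_smult_le])
    ultimately show "degree (p + smult t q) = n" by simp
    show "rsquarefree (p + smult t q)"
      unfolding rsquarefree_roots
    proof (intro allI notI, elim conjE)
      fix u assume "poly (p + smult t q) u = 0" "poly (pderiv (p + smult t q)) u = 0"
      then have e: "poly p u = - t * poly q u" "poly (pderiv p) u = - t * poly (pderiv q) u"
        by (simp_all add: pderiv_add pderiv_smult eq_neg_iff_add_eq_0)
      then have "poly W u = 0" by (simp add: W_def)
      moreover have "poly q u \<noteq> 0" using assms(1)[of u] e(1) by auto
      ultimately show False using t e(1) by (auto simp: image_iff)
    qed
  qed
qed

text \<open>
  \<open>U\<close> plays the role of a hyperplane of polynomials of degree at most \<open>m\<close> with complement spanned by
  \<open>M\<close>; for a nondegenerate pairing its orthogonal space has dimension at most one.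
\<close>

lemma annihilators_dependent:
  assumes nondeg: "\<And>g. annihilates (2 * m) P m g \<Longrightarrow> g = 0"
    and deg: "degree h1 \<le> m" "degree h2 \<le> m"
    and U: "\<And>u. u \<in> U \<Longrightarrow> apolar (2 * m) P (h1 * u) = 0 \<and> apolar (2 * m) P (h2 * u) = 0"
    and span: "\<And>k. degree k \<le> m \<Longrightarrow> \<exists>c u. u \<in> U \<and> k = smult c M + u"
  obtains c e where "c \<noteq> 0 \<or> e \<noteq> 0" "smult c h1 + smult e h2 = 0"
proof -
  define A where "A = apolar (2 * m) P"
  \<comment> \<open>With these weights the combination of h1 and h2 also pairs to zero with M, hence
    with all of U plus the span of M.\<close>
  define c where "c = A (h2 * M)"
  define e where "e = - A (h1 * M)"
  have *: "smult c' h1 + smult e' h2 = 0" if ce: "c' * A (h1 * M) + e' * A (h2 * M) = 0" for c' e'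
  proof (rule nondeg)
    have "degree (smult c' h1 + smult e' h2) \<le> m"
      using deg by (intro degree_add_le) (auto intro: order.trans[OF degree_smult_le])
    moreover have "A ((smult c' h1 + smult e' h2) * k) = 0" if k: "degree k \<le> m" for k
    proof -
      obtain x u where u: "u \<in> U" "k = smult x M + u" using span[OF k] by blast
      have "A ((smult c' h1 + smult e' h2) * k)
          = x * (c' * A (h1 * M) + e' * A (h2 * M)) + c' * A (h1 * u) + e' * A (h2 * u)"
        by (simp add: u(2) A_def apolar_add apolar_smult algebra_simps)
      then show ?thesis using U[OF u(1)] ce by (simp add: A_def)
    qed
    ultimately show "annihilates (2 * m) P m (smult c' h1 + smult e' h2)"
      by (simp add: annihilates_def A_def)
  qed
  show ?thesis
  \<comment> \<open>For e = 0 the weight c may vanish too; but then h1 alone pairs to zero with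
    M.\<close>
  proof (cases "e = 0")
    case True
    then show ?thesis using *[of 1 0] that[of 1 0] by (simp add: e_def)
  next
    case False
    then show ?thesis using *[of c e] that[of c e] by (simp add: c_def e_def)
  qed
qed

text \<open>In degree m + 1 there are m equations in m + 2 unknowns, so two independent annihilators
  p and q exist. A common root could be divided out, leaving two independent polynomials of nominal
  degree m that are orthogonal to a hyperplane, which a nondegenerate pairing forbids.\<close>

lemma waring_le_of_nondegenerate:
  assumes nondeg: "\<And>g. annihilates (2 * m) P m g \<Longrightarrow> g = 0" and m: "m > 0"
  shows "waring_le (2 * m) (m + 1) (hom (2 * m) P)"
proof -
  obtain p where p: "p \<noteq> 0" "annihilates (2 * m) P (m + 1) p"
    using annihilator_exists[of "m + 1" "2 * m" "{}" P] m by auto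
  \<comment> \<open>A pivot: requiring coefficient i of q to vanish makes p and q
    independent.\<close>
  obtain i where i: "coeff p i \<noteq> 0" using p(1) by (metis leading_coeff_0_iff)
  have "i \<le> m + 1" using p(2) i by (metis annihilates_def le_degree order.trans)
  then obtain q where q: "q \<noteq> 0" "annihilates (2 * m) P (m + 1) q" "coeff q i = 0"
    using annihilator_exists[of "m + 1" "2 * m" "{i}" P] m by auto
  have indep: "c = 0 \<and> e = 0" if "smult c p + smult e q = 0" for c e
  proof -
    have "c * coeff p i = 0"
      using arg_cong[OF that, of "\<lambda>f. coeff f i"] q(3) by simp
    then have "c = 0" using i by simp
    then show ?thesis using that q(1) by simp
  qed
  have deg: "degree p \<le> m + 1" "degree q \<le> m + 1"
    using p(2) q(2) by (simp_all add: annihilates_def)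
  have ann: "apolar (2 * m) P (p * u) = 0 \<and> apolar (2 * m) P (q * u) = 0"
    if "degree u \<le> m - 1" for u
    using p(2) q(2) that by (simp add: annihilates_def)
  have no_common: "\<not> (poly p z = 0 \<and> poly q z = 0)" for z
  proof
    assume "poly p z = 0 \<and> poly q z = 0"
    then obtain h1 h2 where h: "p = [:- z, 1:] * h1" "q = [:- z, 1:] * h2"
      by (metis poly_eq_0_iff_dvd dvdE)
    have deg_mult: "degree ([:- z, 1:] * h) = Suc (degree h)" if "h \<noteq> 0" for h
      using that by (subst degree_mult_eq) auto
    have "h1 \<noteq> 0" "h2 \<noteq> 0" using p(1) q(1) h by auto
    then have "degree h1 \<le> m" "degree h2 \<le> m"
      using deg deg_mult[of h1] deg_mult[of h2] unfolding h by linarith+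
    moreover have "\<exists>c u. u \<in> {[:- z, 1:] * u | u. degree u \<le> m - 1} \<and> k = smult c 1 + u"
      if k: "degree k \<le> m" for k :: "complex poly"
    proof -
      have "poly (k - [:poly k z:]) z = 0" by simp
      then obtain u where u: "k - [:poly k z:] = [:- z, 1:] * u"
        by (metis poly_eq_0_iff_dvd dvdE)
      have "degree u \<le> m - 1"
      proof (cases "u = 0")
        case False
        have "degree (k - [:poly k z:]) \<le> m" using k by (intro degree_diff_le) auto
        then show ?thesis using deg_mult[OF False] u by simp
      qed simp
      moreover have "k = smult (poly k z) 1 + [:- z, 1:] * u"
        using u by (simp add: diff_eq_eq add.commute)
      ultimately show ?thesis by blast
    qed
    moreover have "apolar (2 * m) P (h1 * u) = 0 \<and> apolar (2 * m) P (h2 * u) = 0"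
      if u: "u \<in> {[:- z, 1:] * u | u. degree u \<le> m - 1}" for u
    proof -
      obtain w where "u = [:- z, 1:] * w" "degree w \<le> m - 1" using u by blast
      moreover have "h1 * ([:- z, 1:] * w) = p * w" "h2 * ([:- z, 1:] * w) = q * w"
        unfolding h by (simp_all only: mult_ac)
      ultimately show ?thesis using ann[of w] by metis
    qed
    ultimately obtain c e where "c \<noteq> 0 \<or> e \<noteq> 0" "smult c h1 + smult e h2 = 0"
      using annihilators_dependent[of m P h1 h2 "{[:- z, 1:] * u | u. degree u \<le> m - 1}" 1]
      using nondeg by blast
    moreover have "smult c p + smult e q = [:- z, 1:] * (smult c h1 + smult e h2)"
      unfolding h by (simp only: distrib_left mult_smult_right)
    ultimately show False using indep by simp
  qed
  \<comment> \<open>The same argument for a common root at infinity; the hyperplane is now that of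
    degree at most m - 1.\<close>
  have deg_top: "\<not> (degree p \<le> m \<and> degree q \<le> m)"
  proof
    assume d: "degree p \<le> m \<and> degree q \<le> m"
    have "\<exists>c u. u \<in> {u. degree u \<le> m - 1} \<and> k = smult c (monom 1 m) + u"
      if k: "degree k \<le> m" for k :: "complex poly"
    proof -
      have "coeff (k - monom (coeff k m) m) j = 0" if "j > m - 1" for j
        using that k m by (cases "j = m") (auto simp: coeff_eq_0)
      then have "degree (k - monom (coeff k m) m) \<le> m - 1" by (intro degree_le) blast
      moreover have "k = smult (coeff k m) (monom 1 m) + (k - monom (coeff k m) m)"
        by (simp add: smult_monom)
      ultimately show ?thesis by blast
    qed
    then obtain c e where "c \<noteq> 0 \<or> e \<noteq> 0" "smult c p + smult e q = 0"
      using annihilators_dependent[of m P p q "{u. degree u \<le> m - 1}" "monom 1 m"] d ann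
      using nondeg by blast
    then show False using indep by blast
  qed
  \<comment> \<open>Stated for a generic pair because either p or q may be the one of full degree m
    + 1.\<close>
  have conclude: "waring_le (2 * m) (m + 1) (hom (2 * m) P)"
    if pq: "annihilates (2 * m) P (m + 1) p'" "annihilates (2 * m) P (m + 1) q'"
      "\<And>z. \<not> (poly p' z = 0 \<and> poly q' z = 0)" "degree p' \<le> m + 1" "degree q' = m + 1" for p' q'
  proof -
    obtain t where "rsquarefree (p' + smult t q')" "degree (p' + smult t q') = m + 1"
      using pencil_rsquarefree[OF pq(3-5)] by auto
    moreover have "annihilates (2 * m) P (m + 1) (p' + smult t q')"
      using pq by (intro annihilates_add annihilates_smult)
    ultimately show ?thesis using m by (intro waring_le_of_rsquarefree_annihilator) auto
  qed
  show ?thesis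
  proof (cases "degree q = m + 1")
    case True
    then show ?thesis using conclude[of p q] p q no_common deg by blast
  next
    case False
    then have "degree p = m + 1" using deg deg_top by linarith
    then show ?thesis using conclude[of q p] p q no_common deg by blast
  qed
qed

lemma apolar_power: "degree p \<le> d \<Longrightarrow> apolar d ([:1, z:] ^ d) p = poly p z"
  using apolar_power_sum[of d "[:1, z:] ^ d" "\<lambda>_. 1" "\<lambda>_. 1" "\<lambda>_. z" "{()}" p]
  by (simp add: hom_power_linear hom_one_left)

text \<open>Subtracting the power at a point z where the generator of the annihilators does not
  vanish makes the pairing nondegenerate; the subtracted power costs one further summand.\<close>

lemma waring_le_of_corank_le_1:
  assumes span: "\<And>g. annihilates (2 * m) P m g \<Longrightarrow> \<exists>c. g = smult c g1" and m: "m > 0"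
  shows "waring_le (2 * m) (m + 2) (hom (2 * m) P)"
proof (cases "\<forall>g. annihilates (2 * m) P m g \<longrightarrow> g = 0")
  case True
  then have "waring_le (2 * m) (m + 1) (hom (2 * m) P)"
    using m by (intro waring_le_of_nondegenerate) auto
  then show ?thesis using m by (auto intro: waring_le_mono)
next
  case False
  then obtain g where g: "g \<noteq> 0" "annihilates (2 * m) P m g" by blast
  then have span_g: "\<exists>c. h = smult c g" if h: "annihilates (2 * m) P m h" for h
  proof -
    obtain a where "g = smult a g1" using span[OF g(2)] by blast
    moreover obtain b where "h = smult b g1" using span[OF h] by blast
    ultimately have "h = smult (b / a) g" using g(1) by auto
    then show ?thesis ..
  qed
  obtain z where z: "poly g z \<noteq> 0"
    using ex_new_if_finite[OF infinite_UNIV_char_0 poly_roots_finite[OF g(1)]] by auto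
  define Q where "Q = P - [:1, z:] ^ (2 * m)"
  have apolar_Q: "apolar (2 * m) Q p = apolar (2 * m) P p - poly p z" if "degree p \<le> 2 * m" for p
    using that by (simp add: Q_def apolar_diff_left apolar_power)
  have "waring_le (2 * m) (m + 1) (hom (2 * m) Q)"
  proof (rule waring_le_of_nondegenerate[OF _ m])
    fix h assume h: "annihilates (2 * m) Q m h"
    have eq: "apolar (2 * m) P (h * k) = poly h z * poly k z" if "degree k \<le> m" for k
    proof -
      have "degree (h * k) \<le> 2 * m"
        using degree_mult_le[of h k] h that by (simp add: annihilates_def)
      from apolar_Q[OF this] show ?thesis using h that by (simp add: annihilates_def)
    qed
    \<comment> \<open>Testing h against g itself gives h z * g z = 0, so h vanishes at z. Then h
      annihilates P already and is a multiple of g, hence zero.\<close>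
    have "apolar (2 * m) P (g * h) = 0" using g(2) h by (simp add: annihilates_def)
    then have "poly h z = 0"
      using eq[of g] g(2) z by (simp add: annihilates_def mult.commute)
    then have "annihilates (2 * m) P m h" using eq h by (simp add: annihilates_def)
    then obtain c where "h = smult c g" using span_g by blast
    then show "h = 0" using \<open>poly h z = 0\<close> z by simp
  qed
  moreover have "hom (2 * m) Q = (\<lambda>x y. hom (2 * m) P x y - 1 * (1 * x + z * y) ^ (2 * m))"
    by (simp add: fun_eq_iff Q_def hom_diff hom_power_linear)
  ultimately have "waring_le (2 * m) (Suc (m + 1)) (hom (2 * m) P)"
    using m waring_le_add_power[of "2 * m" "m + 1" "hom (2 * m) P" 1 1 z] by simp
  then show ?thesis by simp
qed

subsection \<open>Forms as elements of the polynomial ring\<close>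

definition form_eval :: "complex poly poly \<Rightarrow> complex \<Rightarrow> complex \<Rightarrow> complex" where
  "form_eval f x y = poly (poly f [:y:]) x"

text \<open>The arguments U and V are arbitrary so that the inverse change of coordinates can be
  substituted into a cofactor.\<close>

definition hom_poly :: "nat \<Rightarrow> complex poly \<Rightarrow> complex poly poly \<Rightarrow> complex poly poly \<Rightarrow> complex poly poly" where
  "hom_poly d P U V = (\<Sum>k\<le>d. scalar (coeff P k) * U ^ (d - k) * V ^ k)"

lemma form_eval_simps:
  "form_eval (f + g) x y = form_eval f x y + form_eval g x y"
  "form_eval (f - g) x y = form_eval f x y - form_eval g x y"
  "form_eval (f * g) x y = form_eval f x y * form_eval g x y"
  "form_eval (f ^ n) x y = form_eval f x y ^ n"
  "form_eval (scalar c) x y = c"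
  "form_eval var_x x y = x"
  "form_eval var_y x y = y"
  "form_eval 0 x y = 0"
  "form_eval 1 x y = 1"
  by (simp_all add: form_eval_def poly_power scalar_def var_x_def var_y_def)

lemma form_eval_sum: "form_eval (\<Sum>i\<in>I. f i) x y = (\<Sum>i\<in>I. form_eval (f i) x y)"
  by (simp add: form_eval_def poly_sum)

lemma form_eval_inject:
  assumes "\<And>x y. form_eval f x y = form_eval g x y"
  shows "f = g"
proof (rule ccontr)
  assume "f \<noteq> g"
  then have "finite {u. poly (f - g) u = 0}" by (intro poly_roots_finite) simp
  moreover have "poly (f - g) [:y:] = 0" for y
  proof -
    have "poly (poly f [:y:]) x = poly (poly g [:y:]) x" for x
      using assms by (simp add: form_eval_def)
    then show ?thesis by (simp add: poly_eq_poly_eq_iff[symmetric] fun_eq_iff)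
  qed
  ultimately have "finite (range (\<lambda>y::complex. [:y:]))"
    by (elim finite_subset[rotated]) auto
  moreover have "inj (\<lambda>y::complex. [:y:])" by (auto intro: injI)
  ultimately show False using finite_imageD infinite_UNIV_char_0 by blast
qed

lemma form_eval_hom_poly:
  "form_eval (hom_poly d P U V) x y = hom d P (form_eval U x y) (form_eval V x y)"
  by (simp add: hom_poly_def hom_def form_eval_sum form_eval_simps)

text \<open>Restricts a cofactor to a parametrized line, which carries divisibility in two variables
  over to univariate polynomials.\<close>

lemma form_eval_dehomogenize:
  obtains K where "\<And>t. poly K t = form_eval k (poly u t) (poly v t)"
proof -
  have "\<exists>K. \<forall>t. poly K t = form_eval k (poly u t) (poly v t)"
  proof (induction k)
    case 0
    then show ?case by (intro exI[of _ 0]) (simp add: form_eval_def)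
  next
    case (pCons c k)
    then obtain K where "\<And>t. poly K t = form_eval k (poly u t) (poly v t)" by blast
    then show ?case
      by (intro exI[of _ "pcompose c u + v * K"]) (simp add: form_eval_def poly_pcompose)
  qed
  then show thesis using that by blast
qed

lemma monomial_eq_monom: "scalar c * var_x ^ i * var_y ^ j = monom (monom c i) j"
proof -
  have "var_x ^ i = monom (monom 1 i) 0"
    by (induction i) (simp_all add: var_x_def monom_0 monom_Suc one_pCons)
  moreover have "var_y ^ j = monom 1 j"
    by (simp add: var_y_def monom_altdef)
  ultimately show ?thesis
    by (simp add: scalar_def monom_0 smult_monom mult_monom one_pCons[symmetric])
qed

lemma coeff_hom_poly:
  "coeff (coeff (hom_poly d P var_x var_y) j) i = (if i + j = d then coeff P j else 0)"
proof -
  have "coeff (coeff (hom_poly d P var_x var_y) j) i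
      = (\<Sum>k\<le>d. if k = j then (if d - k = i then coeff P k else 0) else 0)"
    by (simp add: hom_poly_def monomial_eq_monom coeff_sum if_distrib[of "\<lambda>p. coeff p i"] cong: if_cong)
  then show ?thesis by (auto simp: sum.delta)
qed

lemma binary_form_hom_poly: "binary_form d (hom_poly d P var_x var_y)"
  by (simp add: binary_form_def coeff_hom_poly)

lemma binary_form_imp_hom_poly:
  assumes "binary_form d f"
  obtains P where "degree P \<le> d" "f = hom_poly d P var_x var_y"
proof
  let ?P = "\<Sum>k\<le>d. monom (coeff (coeff f k) (d - k)) k"
  show "degree ?P \<le> d"
    by (intro degree_sum_le) (auto intro: order.trans[OF degree_monom_le])
  have c: "coeff ?P j = (if j \<le> d then coeff (coeff f j) (d - j) else 0)" for j
    by (simp add: coeff_sum sum.delta' cong: if_cong)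
  show "f = hom_poly d ?P var_x var_y"
  proof (intro poly_eqI)
    fix j i
    show "coeff (coeff f j) i = coeff (coeff (hom_poly d ?P var_x var_y) j) i"
      unfolding coeff_hom_poly c
      using assms unfolding binary_form_def by (cases "i + j = d") auto
  qed
qed

lemma waring_decomposition_iff:
  "(\<exists>l. (\<forall>i<r. linear_form (l i)) \<and> f = (\<Sum>i<r. l i ^ d)) \<longleftrightarrow> waring_le d r (form_eval f)"
proof
  assume "\<exists>l. (\<forall>i<r. linear_form (l i)) \<and> f = (\<Sum>i<r. l i ^ d)"
  then obtain l where l: "\<forall>i<r. linear_form (l i)" "f = (\<Sum>i<r. l i ^ d)" by blast
  then obtain a b where ab: "\<And>i. i < r \<Longrightarrow> l i = scalar (a i) * var_x + scalar (b i) * var_y"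
    unfolding linear_form_def by metis
  have "form_eval f x y = (\<Sum>i<r. (a i * x + b i * y) ^ d)" for x y
    unfolding l(2) by (simp add: form_eval_sum form_eval_simps ab)
  then show "waring_le d r (form_eval f)" unfolding waring_le_def by blast
next
  assume "waring_le d r (form_eval f)"
  then obtain a b where ab: "\<And>x y. form_eval f x y = (\<Sum>i<r. (a i * x + b i * y) ^ d)"
    unfolding waring_le_def by blast
  let ?l = "\<lambda>i. scalar (a i) * var_x + scalar (b i) * var_y"
  have "f = (\<Sum>i<r. ?l i ^ d)"
    by (rule form_eval_inject) (simp add: form_eval_sum form_eval_simps ab)
  moreover have "\<forall>i<r. linear_form (?l i)" unfolding linear_form_def by blast
  ultimately show "\<exists>l. (\<forall>i<r. linear_form (l i)) \<and> f = (\<Sum>i<r. l i ^ d)"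
    by (intro exI[of _ ?l]) simp
qed

lemma waring_rank_le: "waring_le d r (form_eval f) \<Longrightarrow> waring_rank d f \<le> r"
  unfolding waring_rank_def waring_decomposition_iff by (rule Least_le)

text \<open>The first assumption guarantees that \<open>LEAST\<close> picks an actual
  decomposition.\<close>

lemma waring_rank_ge:
  assumes "waring_le d r (form_eval f)" "\<And>s. s < n \<Longrightarrow> \<not> waring_le d s (form_eval f)"
  shows "n \<le> waring_rank d f"
proof -
  have "waring_le d (waring_rank d f) (form_eval f)"
    unfolding waring_rank_def waring_decomposition_iff using assms(1) by (rule LeastI)
  then show ?thesis using assms(2) not_le_imp_less by blast
qed

text \<open>Along the line x = 1 of the new coordinates the factor B x - A y becomes the stated
  linear polynomial.\<close>

lemma dvd_dehomogenize:
  assumes "(scalar B * var_x - scalar A * var_y) ^ n dvd f" "degree P \<le> d"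
    and "\<And>x y. form_eval f (a * x + a' * y) (b * x + b' * y) = hom d P x y"
  shows "[:B * a - A * b, B * a' - A * b':] ^ n dvd P"
proof -
  obtain k where k: "f = (scalar B * var_x - scalar A * var_y) ^ n * k"
    using assms(1) by (auto elim: dvdE)
  obtain K where K: "\<And>t. poly K t = form_eval k (poly [:a, a':] t) (poly [:b, b':] t)"
    using form_eval_dehomogenize by metis
  have "poly P t = poly ([:B * a - A * b, B * a' - A * b':] ^ n * K) t" for t
  proof -
    have "poly P t = form_eval f (a + a' * t) (b + b' * t)"
      using assms(3)[of 1 t] assms(2) by (simp add: hom_one_left)
    also have "\<dots> = (B * (a + a' * t) - A * (b + b' * t)) ^ n * poly K t"
      by (simp add: k form_eval_simps K mult.commute)
    also have "B * (a + a' * t) - A * (b + b' * t) = poly [:B * a - A * b, B * a' - A * b':] t"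
      by (simp add: algebra_simps)
    finally show ?thesis by (simp add: poly_power)
  qed
  then have "P = [:B * a - A * b, B * a' - A * b':] ^ n * K"
    by (simp add: poly_eq_poly_eq_iff[symmetric] fun_eq_iff)
  then show ?thesis by simp
qed

lemma dvd_homogenize:
  assumes "a * b' \<noteq> a' * b" "(u, v) \<noteq> (0, 0)"
    and "\<And>x y. form_eval f (a * x + a' * y) (b * x + b' * y) = (u * x + v * y) ^ n * hom m Q x y"
  obtains A B where "(A, B) \<noteq> (0, 0)" "(scalar B * var_x - scalar A * var_y) ^ n dvd f"
proof -
  define D where "D = a * b' - a' * b"
  have D: "D \<noteq> 0" using assms(1) by (simp add: D_def)
  \<comment> \<open>Cramer's rule: inverting the substitution turns u x + v y into B x - A
    y.\<close>
  define B where "B = (u * b' - v * b) / D"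
  define A where "A = (u * a' - v * a) / D"
  let ?U = "scalar (b' / D) * var_x + scalar (- a' / D) * var_y"
  let ?V = "scalar (- b / D) * var_x + scalar (a / D) * var_y"
  have "f = (scalar B * var_x - scalar A * var_y) ^ n * hom_poly m Q ?U ?V"
  proof (rule form_eval_inject)
    fix x y
    define X where "X = b' / D * x + - a' / D * y"
    define Y where "Y = - b / D * x + a / D * y"
    have "D * (a * X + a' * Y) = D * x" "D * (b * X + b' * Y) = D * y"
      using D by (simp_all add: X_def Y_def field_simps) (simp_all add: D_def algebra_simps)
    then have "form_eval f x y = (u * X + v * Y) ^ n * hom m Q X Y"
      using assms(3)[of X Y] D by simp
    also have "u * X + v * Y = B * x - A * y"
      using D by (simp add: X_def Y_def A_def B_def field_simps)
    finally show "form_eval f x y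
        = form_eval ((scalar B * var_x - scalar A * var_y) ^ n * hom_poly m Q ?U ?V) x y"
      by (simp add: form_eval_simps form_eval_hom_poly X_def Y_def)
  qed
  moreover have "(A, B) \<noteq> (0, 0)"
  proof
    assume "(A, B) = (0, 0)"
    then have "u * b' = v * b" "u * a' = v * a" using D by (simp_all add: A_def B_def)
    then have "u * D = 0" "v * D = 0" unfolding D_def by algebra+
    then show False using D assms(2) by simp
  qed
  ultimately show ?thesis using that by (metis dvd_triv_left)
qed

lemma linear_power_dvd_iff:
  assumes "(a, b) \<noteq> (0, 0)" "f \<noteq> 0"
  shows "(scalar b * var_x - scalar a * var_y) ^ n dvd f
    \<longleftrightarrow> n \<le> root_mult f (proj_rel `` {(a, b)})"
proof -
  let ?L = "scalar b * var_x - scalar a * var_y"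
  \<comment> \<open>The linear form vanishes at (a, b), where a unit cannot vanish.\<close>
  have "\<not> is_unit ?L"
  proof
    assume "is_unit ?L"
    then obtain k where "1 = ?L * k" by (auto elim: dvdE)
    then have "form_eval 1 a b = form_eval (?L * k) a b" by simp
    then show False by (simp add: form_eval_simps)
  qed
  then show ?thesis
    using power_dvd_iff_le_multiplicity[of f ?L n] assms by (simp add: root_mult_class)
qed

section \<open>Points of the projective line and their multiplicities\<close>

lemma proj_class_eq_iff:
  assumes "(a, b) \<noteq> (0, 0)" "(a', b') \<noteq> (0, 0)"
  shows "proj_rel `` {(a, b)} = proj_rel `` {(a', b')} \<longleftrightarrow> a * b' = a' * b"
proof -
  have "proj_rel `` {(a, b)} = proj_rel `` {(a', b')} \<longleftrightarrow> ((a, b), (a', b')) \<in> proj_rel"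
    using eq_equiv_class_iff[OF equiv_proj_rel] assms by simp
  also have "\<dots> \<longleftrightarrow> a * b' = a' * b"
  proof
    assume "((a, b), (a', b')) \<in> proj_rel"
    then show "a * b' = a' * b" by (auto simp: proj_rel_def)
  next
    assume eq: "a * b' = a' * b"
    show "((a, b), (a', b')) \<in> proj_rel"
    proof (cases "a = 0")
      case True
      then have "b \<noteq> 0" "a' = 0" "b' \<noteq> 0" using assms eq by auto
      then show ?thesis using True by (auto simp: proj_rel_def intro!: exI[of _ "b' / b"])
    next
      case False
      then have "a' \<noteq> 0" using assms eq by auto
      then show ?thesis using False eq
        by (auto simp: proj_rel_def field_simps intro!: exI[of _ "a' / a"])
    qed
  qed
  finally show ?thesis .
qed

lemma P1_cases:
  assumes "p \<in> P1"
  obtains a b where "(a, b) \<noteq> (0, 0)" "p = proj_rel `` {(a, b)}"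
  using assms unfolding P1_def by (auto elim!: quotientE)

lemma proj_class_in_P1: "(a, b) \<noteq> (0, 0) \<Longrightarrow> proj_rel `` {(a, b)} \<in> P1"
  unfolding P1_def by (intro quotientI) simp

lemma no_cubic_factor:
  assumes "sextic_mult_le_2 f" "(a, b) \<noteq> (0, 0)"
  shows "\<not> (scalar b * var_x - scalar a * var_y) ^ 3 dvd f"
proof
  let ?p = "proj_rel `` {(a, b)}"
  assume "(scalar b * var_x - scalar a * var_y) ^ 3 dvd f"
  then have "3 \<le> root_mult f ?p"
    using assms by (simp add: linear_power_dvd_iff sextic_mult_le_2_def)
  moreover from this have "?p \<in> roots f"
    using proj_class_in_P1[OF assms(2)] by (simp add: roots_def)
  ultimately show False using assms(1) by (force simp: sextic_mult_le_2_def)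
qed

section \<open>Roots of the homogenization of a polynomial of exact degree d, all of them
  affine\<close>

context
  fixes d :: nat and P :: "complex poly" and f :: "complex poly poly"
  assumes deg: "degree P = d" and d: "d > 0"
  defines "f \<equiv> hom_poly d P var_x var_y"
begin

lemma poly_nonzero_of_degree_pos: "P \<noteq> 0"
  using deg d by auto

lemma hom_poly_nonzero: "f \<noteq> 0"
proof
  assume "f = 0"
  then have "hom d P 1 y = 0" for y
    using form_eval_hom_poly[of d P var_x var_y 1 y] by (simp add: f_def form_eval_simps)
  then have "poly P y = 0" for y using deg by (simp add: hom_one_left)
  then show False using poly_nonzero_of_degree_pos poly_all_0_iff_0 by blast
qed

lemma root_mult_affine_point: "root_mult f (proj_rel `` {(1, v)}) = order v P"
proof -
  have "n \<le> root_mult f (proj_rel `` {(1, v)}) \<longleftrightarrow> n \<le> order v P" for n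
  proof -
    have "n \<le> root_mult f (proj_rel `` {(1, v)})
        \<longleftrightarrow> (scalar v * var_x - scalar 1 * var_y) ^ n dvd f"
      using hom_poly_nonzero by (simp add: linear_power_dvd_iff)
    also have "\<dots> \<longleftrightarrow> [:- v, 1:] ^ n dvd P"
    proof
      assume "(scalar v * var_x - scalar 1 * var_y) ^ n dvd f"
      then have "[:v * 1 - 1 * 0, v * 0 - 1 * 1:] ^ n dvd P"
        by (rule dvd_dehomogenize[where d = d])
          (simp_all add: deg f_def form_eval_hom_poly form_eval_simps)
      moreover have "[:v, - 1:] ^ n = smult ((- 1) ^ n) ([:- v, 1:] ^ n)"
        using smult_power[of "- 1" "[:- v, 1:]" n] by simp
      ultimately show "[:- v, 1:] ^ n dvd P" by (simp add: smult_dvd_iff)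
    next
      assume dvd: "[:- v, 1:] ^ n dvd P"
      then obtain Q where Q: "P = [:- v, 1:] ^ n * Q" by (auto elim: dvdE)
      have Q0: "Q \<noteq> 0" using Q poly_nonzero_of_degree_pos by auto
      have degs: "n + degree Q = d"
        using deg Q0 unfolding Q by (simp add: degree_mult_eq degree_linear_power)
      have "f = (scalar v * var_x - scalar 1 * var_y) ^ n * ((- 1) ^ n * hom_poly (degree Q) Q var_x var_y)"
      proof (rule form_eval_inject)
        fix x y
        have "hom (n + degree Q) ([:- v, 1:] ^ n * Q) x y = hom n ([:- v, 1:] ^ n) x y * hom (degree Q) Q x y"
          by (intro hom_mult degree_power_linear_le) simp
        then have "form_eval f x y = (- v * x + 1 * y) ^ n * hom (degree Q) Q x y"
          unfolding f_def by (simp add: form_eval_hom_poly form_eval_simps hom_power_linear degs Q[symmetric])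
        moreover have "(- v * x + 1 * y) ^ n = (v * x - 1 * y) ^ n * (- 1) ^ n"
          by (simp add: power_mult_distrib[symmetric])
        moreover have "form_eval ((- 1) ^ n) x y = (- 1) ^ n"
          by (simp add: form_eval_def poly_power)
        ultimately show "form_eval f x y = form_eval ((scalar v * var_x - scalar 1 * var_y) ^ n
            * ((- 1) ^ n * hom_poly (degree Q) Q var_x var_y)) x y"
          by (simp add: form_eval_simps(1-7) form_eval_hom_poly)
      qed
      then show "(scalar v * var_x - scalar 1 * var_y) ^ n dvd f" by simp
    qed
    also have "\<dots> \<longleftrightarrow> n \<le> order v P" using poly_nonzero_of_degree_pos by (simp add: order_divides)
    finally show ?thesis .
  qed
  then show ?thesis by (meson order.antisym order.refl)
qed

lemma root_mult_point_at_infinity: "root_mult f (proj_rel `` {(0, 1)}) = 0"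
proof (rule ccontr)
  assume "root_mult f (proj_rel `` {(0, 1)}) \<noteq> 0"
  then have "1 \<le> root_mult f (proj_rel `` {(0, 1)})" by simp
  then have "(scalar 1 * var_x - scalar 0 * var_y) ^ 1 dvd f"
    using hom_poly_nonzero by (subst linear_power_dvd_iff) auto
  then obtain k where "f = (scalar 1 * var_x - scalar 0 * var_y) ^ 1 * k" by (auto elim: dvdE)
  then have "form_eval f 0 1 = 0" by (simp add: form_eval_simps)
  then have "coeff P d = 0"
    by (simp add: f_def form_eval_hom_poly form_eval_simps hom_zero_left)
  then show False using deg poly_nonzero_of_degree_pos by auto
qed

lemma points_with_root_mult:
  assumes "\<not> R 0"
  shows "{p \<in> P1. R (root_mult f p)} = (\<lambda>v. proj_rel `` {(1, v)}) ` {v. R (order v P)}"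
proof (intro equalityI subsetI)
  fix p assume "p \<in> {p \<in> P1. R (root_mult f p)}"
  then have p: "p \<in> P1" "R (root_mult f p)" by auto
  obtain a b where ab: "(a, b) \<noteq> (0, 0)" "p = proj_rel `` {(a, b)}"
    using p(1) by (rule P1_cases)
  show "p \<in> (\<lambda>v. proj_rel `` {(1, v)}) ` {v. R (order v P)}"
  proof (cases "a = 0")
    case True
    then have "p = proj_rel `` {(0, 1)}" unfolding ab(2) using ab by (subst proj_class_eq_iff) auto
    then show ?thesis using p(2) assms root_mult_point_at_infinity by simp
  next
    case False
    then have "p = proj_rel `` {(1, b / a)}" unfolding ab(2) using ab by (subst proj_class_eq_iff) auto
    then show ?thesis using p(2) root_mult_affine_point by auto
  qed
next
  fix p assume "p \<in> (\<lambda>v. proj_rel `` {(1, v)}) ` {v. R (order v P)}"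
  then show "p \<in> {p \<in> P1. R (root_mult f p)}"
    using root_mult_affine_point by (auto intro: proj_class_in_P1)
qed

lemma inj_affine_point: "inj_on (\<lambda>v. proj_rel `` {(1 :: complex, v)}) S"
  by (auto intro!: inj_onI simp: proj_class_eq_iff)

lemma card_roots_form: "card (roots f) = card {v. poly P v = 0}"
proof -
  have "roots f = (\<lambda>v. proj_rel `` {(1, v)}) ` {v. 1 \<le> order v P}"
    unfolding roots_def by (rule points_with_root_mult) simp
  moreover have "{v. 1 \<le> order v P} = {v. poly P v = 0}"
    using poly_nonzero_of_degree_pos by (auto simp: order_root)
  ultimately show ?thesis by (simp add: card_image[OF inj_affine_point])
qed

lemma card_double_roots_form: "card (double_roots f) = card {v. order v P = 2}"
proof -
  have "double_roots f = (\<lambda>v. proj_rel `` {(1, v)}) ` {v. order v P = 2}"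
    unfolding double_roots_def by (rule points_with_root_mult) simp
  then show ?thesis by (simp add: card_image[OF inj_affine_point])
qed

lemma root_mult_le_form:
  assumes "\<And>v. order v P \<le> m" "p \<in> P1"
  shows "root_mult f p \<le> m"
proof (rule ccontr)
  assume "\<not> root_mult f p \<le> m"
  then have "p \<in> {p \<in> P1. m < root_mult f p}" using assms(2) by simp
  then show False unfolding points_with_root_mult[of "\<lambda>k. m < k", simplified] using assms(1)
    by (auto simp: not_less[symmetric])
qed

end

lemma order_eq_of_pderiv:
  fixes P :: "complex poly"
  assumes "P \<noteq> 0" "\<And>v. \<not> (poly P v = 0 \<and> poly (pderiv P) v = 0 \<and> poly (pderiv (pderiv P)) v = 0)"
  shows "order v P \<le> 2" "order v P = 2 \<longleftrightarrow> poly P v = 0 \<and> poly (pderiv P) v = 0"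
proof -
  have "order v P \<le> 2 \<and> (order v P = 2 \<longleftrightarrow> poly P v = 0 \<and> poly (pderiv P) v = 0)"
  proof (cases "poly P v = 0")
    case True
    then have o: "order v P = Suc (order v (pderiv P))" using assms(1) order_pderiv by blast
    have P': "pderiv P \<noteq> 0"
      using True assms(1) by (metis degree_0 order.refl order_root pderiv_0 pderiv_eq_0_iff poly_0 poly_const_conv degree_eq_zeroE)
    show ?thesis
    proof (cases "poly (pderiv P) v = 0")
      case True': True
      then have "order v (pderiv P) = Suc (order v (pderiv (pderiv P)))" using P' order_pderiv by blast
      moreover have "order v (pderiv (pderiv P)) = 0"
        using assms(2)[of v] True True' by (intro order_0I) auto
      ultimately show ?thesis using o True True' by simp
    next
      case False
      then have "order v (pderiv P) = 0" by (rule order_0I)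
      then show ?thesis using o False by simp
    qed
  qed (simp add: order_0I)
  then show "order v P \<le> 2" "order v P = 2 \<longleftrightarrow> poly P v = 0 \<and> poly (pderiv P) v = 0" by auto
qed

text \<open>Reduces the root conditions on an explicit example to common zeros of P and its first
  two derivatives, since in characteristic 0 differentiation lowers a positive order by one.\<close>

lemma sextic_form:
  assumes "degree P = 6"
    and "\<And>v. \<not> (poly P v = 0 \<and> poly (pderiv P) v = 0 \<and> poly (pderiv (pderiv P)) v = 0)"
  defines "f \<equiv> hom_poly 6 P var_x var_y"
  shows "sextic_mult_le_2 f"
    and "card (double_roots f) = card {v. poly P v = 0 \<and> poly (pderiv P) v = 0}"
    and "card (roots f) = card {v. poly P v = 0}"
proof -
  have P: "P \<noteq> 0" using assms(1) by auto
  note order = order_eq_of_pderiv[OF P assms(2)]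
  show "sextic_mult_le_2 f"
    using root_mult_le_form[OF assms(1) _ order(1)] hom_poly_nonzero[OF assms(1)] binary_form_hom_poly
    by (auto simp: sextic_mult_le_2_def f_def roots_def)
  show "card (double_roots f) = card {v. poly P v = 0 \<and> poly (pderiv P) v = 0}"
    unfolding f_def by (simp add: card_double_roots_form[OF assms(1)] order(2))
  show "card (roots f) = card {v. poly P v = 0}"
    unfolding f_def by (simp add: card_roots_form[OF assms(1)])
qed

subsection \<open>Sextics in normalized coordinates\<close>

lemma annihilates_sextic_2:
  assumes "\<And>k. k \<le> 6 \<Longrightarrow> a k = coeff P k / of_nat (6 choose k)"
  shows "annihilates 6 P 2 g \<longleftrightarrow> degree g \<le> 2 \<and>
    (\<forall>j\<le>4. coeff g 0 * a j + coeff g 1 * a (j + 1) + coeff g 2 * a (j + 2) = 0)"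
proof -
  have "(\<Sum>k\<le>2. coeff g k * (coeff P (k + j) / of_nat (6 choose (k + j))))
      = coeff g 0 * a j + coeff g 1 * a (j + 1) + coeff g 2 * a (j + 2)" if "j \<le> 4" for j
    using assms[of j] assms[of "j + 1"] assms[of "j + 2"] that
    by (simp add: numeral_2_eq_2)
  then show ?thesis by (subst annihilates_iff) auto
qed

lemma annihilates_sextic_3:
  assumes "\<And>k. k \<le> 6 \<Longrightarrow> a k = coeff P k / of_nat (6 choose k)"
  shows "annihilates 6 P 3 g \<longleftrightarrow> degree g \<le> 3 \<and>
    (\<forall>j\<le>3. coeff g 0 * a j + coeff g 1 * a (j + 1) + coeff g 2 * a (j + 2)
      + coeff g 3 * a (j + 3) = 0)"
proof -
  have "(\<Sum>k\<le>3. coeff g k * (coeff P (k + j) / of_nat (6 choose (k + j))))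
      = coeff g 0 * a j + coeff g 1 * a (j + 1) + coeff g 2 * a (j + 2) + coeff g 3 * a (j + 3)"
    if "j \<le> 3" for j
    using assms[of j] assms[of "j + 1"] assms[of "j + 2"] assms[of "j + 3"] that
    by (simp add: numeral_3_eq_3 numeral_2_eq_2)
  then show ?thesis by (subst annihilates_iff) auto
qed

lemma poly_eq_0_of_coeffs:
  assumes "degree g \<le> n" "\<And>k. k \<le> n \<Longrightarrow> coeff g k = 0"
  shows "g = 0"
  using assms by (intro poly_eqI) (metis coeff_0 coeff_eq_0 leI le_less_trans)

lemma le_3_iff: "k \<le> (3::nat) \<longleftrightarrow> k = 0 \<or> k = 1 \<or> k = 2 \<or> k = 3"
  by auto

lemma le_2_iff: "k \<le> (2::nat) \<longleftrightarrow> k = 0 \<or> k = 1 \<or> k = 2"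
  by auto

lemma not_waring_le_of_no_annihilator:
  assumes "\<And>g. annihilates d P r g \<Longrightarrow> g = 0" "r \<le> d" "d > 0" "s \<le> r"
  shows "\<not> waring_le d s (hom d P)"
  using assms waring_le_imp_annihilator waring_le_mono by metis

text \<open>If a single coefficient determines an annihilator, the annihilators of degree m form a
  space of dimension at most one.\<close>

lemma waring_le_of_coeff_determined:
  assumes "\<And>g. annihilates (2 * m) P m g \<Longrightarrow> coeff g i = 0 \<Longrightarrow> g = 0" "m > 0"
  shows "waring_le (2 * m) (m + 2) (hom (2 * m) P)"
proof (cases "\<forall>g. annihilates (2 * m) P m g \<longrightarrow> g = 0")
  case True
  then show ?thesis using assms(2) by (intro waring_le_of_corank_le_1[where ?g1.0 = 0]) auto
next
  case False
  then obtain g where g: "g \<noteq> 0" "annihilates (2 * m) P m g" by blast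
  then have gi: "coeff g i \<noteq> 0" using assms(1) by blast
  have "\<exists>c. h = smult c g" if h: "annihilates (2 * m) P m h" for h
  proof -
    have "h - smult (coeff h i / coeff g i) g = 0"
      using g h gi by (intro assms(1) annihilates_diff annihilates_smult) simp_all
    then show ?thesis by auto
  qed
  then show ?thesis using assms(2) by (rule waring_le_of_corank_le_1)
qed

text \<open>With the divided coefficients 0, 0 and a nonzero a 2 in front, both Hankel systems are
  triangular: no quadric annihilates, and an annihilating cubic is determined by its top
  coefficient.\<close>

lemma double_root_bounds:
  assumes "coeff P 0 = 0" "coeff P 1 = 0" "coeff P 2 \<noteq> 0"
  shows "r < 3 \<Longrightarrow> \<not> waring_le 6 r (hom 6 P)"
    and "waring_le 6 5 (hom 6 P)"
proof -
  define a where "a k = coeff P k / of_nat (6 choose k)" for k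
  have a: "a 0 = 0" "a 1 = 0" "a 2 \<noteq> 0"
    using assms by (simp_all add: a_def eval_nat_numeral)
  show "\<not> waring_le 6 r (hom 6 P)" if "r < 3"
  proof (rule not_waring_le_of_no_annihilator)
    fix g assume "annihilates 6 P 2 g"
    then have g: "degree g \<le> 2" "\<And>j. j \<le> 4 \<Longrightarrow>
        coeff g 0 * a j + coeff g 1 * a (j + 1) + coeff g 2 * a (j + 2) = 0"
      by (simp_all add: annihilates_sextic_2[OF a_def])
    have g2: "coeff g 2 = 0" using g(2)[of 0] a by (simp add: numeral_2_eq_2)
    have g1: "coeff g 1 = 0" using g(2)[of 1] a g2 by (simp add: numeral_2_eq_2)
    have "coeff g 0 = 0" using g(2)[of 2] a g1 g2 by simp
    then show "g = 0" using g(1) g1 g2 by (intro poly_eq_0_of_coeffs[of g 2]) (auto simp: le_2_iff)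
  qed (use that in auto)
  have "waring_le (2 * 3) (3 + 2) (hom (2 * 3) P)"
  proof (rule waring_le_of_coeff_determined)
    fix g assume "annihilates (2 * 3) P 3 g" and g3: "coeff g 3 = 0"
    then have g: "degree g \<le> 3" "\<And>j. j \<le> 3 \<Longrightarrow> coeff g 0 * a j + coeff g 1 * a (j + 1)
        + coeff g 2 * a (j + 2) + coeff g 3 * a (j + 3) = 0"
      by (simp_all add: annihilates_sextic_3[OF a_def])
    have g2: "coeff g 2 = 0" using g(2)[of 0] a g3 by (simp add: numeral_2_eq_2)
    have g1: "coeff g 1 = 0" using g(2)[of 1] a g2 g3 by (simp add: numeral_2_eq_2)
    have "coeff g 0 = 0" using g(2)[of 2] a g1 g2 g3 by simp
    then show "g = 0" using g(1) g1 g2 g3 by (intro poly_eq_0_of_coeffs[of g 3]) (auto simp: le_3_iff)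
  qed simp
  then show "waring_le 6 5 (hom 6 P)" by simp
qed

text \<open>Phrased on values of the homogenization, so that the triple root may also lie at
  infinity.\<close>

definition has_cubic_factor :: "complex poly \<Rightarrow> bool" where
  "has_cubic_factor P \<longleftrightarrow> (\<exists>u v Q. (u, v) \<noteq> (0, 0) \<and>
    (\<forall>x y. hom 6 P x y = (u * x + v * y) ^ 3 * hom 3 Q x y))"

text \<open>If five summands did not suffice, the annihilating cubics would form at least a plane.
  Eliminating coefficients there leaves a quadric: squarefree, it gives rank at most 2; with a
  double root, it forces a factor of multiplicity 5.\<close>

lemma simple_root_bounds:
  assumes "coeff P 0 = 0" "coeff P 1 \<noteq> 0"
    and no_cube: "\<not> has_cubic_factor P"
  shows "r < 2 \<Longrightarrow> \<not> waring_le 6 r (hom 6 P)"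
    and "waring_le 6 5 (hom 6 P)"
proof -
  define a where "a k = coeff P k / of_nat (6 choose k)" for k
  have a: "a 0 = 0" "a 1 \<noteq> 0"
    using assms by (simp_all add: a_def)
  show "\<not> waring_le 6 r (hom 6 P)" if "r < 2"
  proof (rule not_waring_le_of_no_annihilator)
    fix g assume "annihilates 6 P 1 g"
    then have g: "degree g \<le> 1" "\<And>j. j \<le> 5 \<Longrightarrow> coeff g 0 * a j + coeff g 1 * a (j + 1) = 0"
      by (auto simp: annihilates_iff a_def)
    have g1: "coeff g 1 = 0" using g(2)[of 0] a by simp
    then have "coeff g 0 = 0" using g(2)[of 1] a by simp
    then show "g = 0" using g(1) g1 by (intro poly_eq_0_of_coeffs[of g 1]) (auto simp: le_Suc_eq)
  qed (use that in auto)
  have ann3: "degree g \<le> 3 \<and> (\<forall>j\<le>3. coeff g 0 * a j + coeff g 1 * a (j + 1)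
        + coeff g 2 * a (j + 2) + coeff g 3 * a (j + 3) = 0)" if "annihilates 6 P 3 g" for g
    using that by (simp add: annihilates_sextic_3[OF a_def])
  show "waring_le 6 5 (hom 6 P)"
  proof (rule ccontr)
    assume neg: "\<not> waring_le 6 5 (hom 6 P)"
    \<comment> \<open>In a space of dimension at least two, any chosen coefficient vanishes on some
      nonzero member.\<close>
    have ex: "\<exists>g. annihilates 6 P 3 g \<and> coeff g i = 0 \<and> g \<noteq> 0" for i
      using waring_le_of_coeff_determined[of 3 P i] neg by auto
    obtain g where g: "annihilates 6 P 3 g" "coeff g 3 = 0" "g \<noteq> 0" using ex by blast
    obtain h where h: "annihilates 6 P 3 h" "coeff h 2 = 0" "h \<noteq> 0" using ex by blast
    note eg = ann3[OF g(1), THEN conjunct2, rule_format]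
    note eh = ann3[OF h(1), THEN conjunct2, rule_format]
    have deg_g: "degree g \<le> 2"
      using ann3[OF g(1)] g(2) by (metis eval_nat_numeral(3) le_Suc_eq leading_coeff_0_iff degree_0 zero_le)
    have g2: "coeff g 2 \<noteq> 0"
    proof
      assume g2: "coeff g 2 = 0"
      have g1: "coeff g 1 = 0" using eg[of 0] a g(2) g2 by simp
      have "coeff g 0 = 0" using eg[of 1] a g(2) g1 g2 by simp
      then show False using poly_eq_0_of_coeffs[of g 2] deg_g g1 g2 g(3) by (auto simp: le_2_iff)
    qed
    have h3: "coeff h 3 \<noteq> 0"
    proof
      assume h3: "coeff h 3 = 0"
      have h1: "coeff h 1 = 0" using eh[of 0] a h(2) h3 by simp
      have "coeff h 0 = 0" using eh[of 1] a h(2) h1 h3 by simp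
      then show False using poly_eq_0_of_coeffs[of h 3] ann3[OF h(1)] h1 h(2) h3 h(3)
        by (auto simp: le_3_iff)
    qed
    \<comment> \<open>The recurrence \<open>g\<close> extends by one index because \<open>h\<close> expresses \<open>a 6\<close> by earlier terms.\<close>
    have "coeff g 0 * a 4 + coeff g 1 * a 5 + coeff g 2 * a 6 = 0"
    proof -
      have "coeff h 3 * (coeff g 0 * a 4 + coeff g 1 * a 5 + coeff g 2 * a 6) = 0"
        using eg[of 0] eg[of 1] eg[of 2] eg[of 3] eh[of 0] eh[of 1] eh[of 2] eh[of 3] g(2) h(2)
        by (simp add: eval_nat_numeral) algebra
      then show ?thesis using h3 by simp
    qed
    then have rec: "coeff g 0 * a j + coeff g 1 * a (j + 1) + coeff g 2 * a (j + 2) = 0" if "j \<le> 4" for j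
      using eg[of j] g(2) that by (cases "j = 4") auto
    then have ann2: "annihilates 6 P 2 g" using deg_g by (simp add: annihilates_sextic_2[OF a_def])
    have deg2: "degree g = 2" using deg_g g2 by (simp add: le_antisym le_degree)
    have "\<not> rsquarefree g"
    proof
      assume "rsquarefree g"
      then have "waring_le 6 2 (hom 6 P)"
        using ann2 deg2 by (intro waring_le_of_rsquarefree_annihilator) auto
      then show False using neg waring_le_mono by force
    qed
    then obtain u where u: "poly g u = 0" "poly (pderiv g) u = 0"
      by (auto simp: rsquarefree_roots)
    have "coeff g 0 + coeff g 1 * u + coeff g 2 * u ^ 2 = 0"
      using u(1) deg2 by (simp add: poly_altdef numeral_2_eq_2)
    moreover have "coeff g 1 + 2 * coeff g 2 * u = 0"
    proof -
      have "degree (pderiv g) = 1" using deg2 by (simp add: degree_pderiv)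
      then show ?thesis using u(2) by (simp add: poly_altdef coeff_pderiv numeral_2_eq_2)
    qed
    ultimately have g01: "coeff g 1 = - 2 * u * coeff g 2" "coeff g 0 = u ^ 2 * coeff g 2"
      by algebra+
    \<comment> \<open>Here g is a multiple of the square of t - u, so the recurrence has the double
      characteristic root u. Since a 0 = 0, its solution is a k = k * u ^ (k - 1) * a 1.\<close>
    have step: "a (j + 2) = 2 * u * a (j + 1) - u ^ 2 * a j" if "j \<le> 4" for j
    proof -
      have "coeff g 2 * (a (j + 2) - (2 * u * a (j + 1) - u ^ 2 * a j)) = 0"
        using rec[OF that] unfolding g01 by (simp add: algebra_simps)
      then show ?thesis using g2 by simp
    qed
    have a2: "a 2 = 2 * u * a 1" using step[of 0] a by (simp add: eval_nat_numeral)
    have a3: "a 3 = 3 * u ^ 2 * a 1" using step[of 1] a2 by (simp add: eval_nat_numeral)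
    have a4: "a 4 = 4 * u ^ 3 * a 1" using step[of 2] a2 a3 by (simp add: eval_nat_numeral)
    have a5: "a 5 = 5 * u ^ 4 * a 1" using step[of 3] a3 a4 by (simp add: eval_nat_numeral)
    have a6: "a 6 = 6 * u ^ 5 * a 1" using step[of 4] a4 a5 by (simp add: eval_nat_numeral)
    have c: "coeff P k = of_nat (6 choose k) * a k" if "k \<le> 6" for k
      using that by (simp add: a_def)
    \<comment> \<open>Solving the recurrence gives the form \<open>6 a\<^sub>1 y (x + u y)\<^sup>5\<close>.\<close>
    let ?Q = "[:0, 6 * a 1, 12 * u * a 1, 6 * u ^ 2 * a 1:]"
    have "hom 6 P x y = (1 * x + u * y) ^ 3 * hom 3 ?Q x y" for x y
    proof -
      have "hom 6 P x y = a 0 * x ^ 6 + 6 * a 1 * x ^ 5 * y + 15 * a 2 * x ^ 4 * y ^ 2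
        + 20 * a 3 * x ^ 3 * y ^ 3 + 15 * a 4 * x ^ 2 * y ^ 4 + 6 * a 5 * x * y ^ 5 + a 6 * y ^ 6"
        using c[of 0] c[of 1] c[of 2] c[of 3] c[of 4] c[of 5] c[of 6]
        by (simp add: hom_def eval_nat_numeral)
      moreover have "hom 3 ?Q x y = 6 * a 1 * x ^ 2 * y + 12 * u * a 1 * x * y ^ 2 + 6 * u ^ 2 * a 1 * y ^ 3"
        by (simp add: hom_def eval_nat_numeral)
      moreover have "6 * c * x ^ 5 * y + 15 * (2 * u * c) * x ^ 4 * y ^ 2
        + 20 * (3 * u ^ 2 * c) * x ^ 3 * y ^ 3 + 15 * (4 * u ^ 3 * c) * x ^ 2 * y ^ 4
        + 6 * (5 * u ^ 4 * c) * x * y ^ 5 + 6 * u ^ 5 * c * y ^ 6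
        = (1 * x + u * y) ^ 3 * (6 * c * x ^ 2 * y + 12 * u * c * x * y ^ 2 + 6 * u ^ 2 * c * y ^ 3)" for c
        by algebra
      ultimately show ?thesis by (simp only: a(1) a2 a3 a4 a5 a6 mult_zero_left add_0)
    qed
    moreover have "(1 :: complex, u) \<noteq> (0, 0)" by simp
    ultimately show False using no_cube unfolding has_cubic_factor_def by blast
  qed
qed

text \<open>Failure of rank at most 4 would provide an annihilating cubic. The point is that this
  cubic has degree 3 and is squarefree, so the rank would even be at most 3.\<close>

lemma two_double_roots_bound:
  assumes "coeff P 0 = 0" "coeff P 1 = 0" "coeff P 2 \<noteq> 0" "coeff P 4 \<noteq> 0" "coeff P 5 = 0" "coeff P 6 = 0"
  shows "waring_le 6 4 (hom 6 P)"
proof (rule ccontr)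
  assume neg: "\<not> waring_le 6 4 (hom 6 P)"
  define a where "a k = coeff P k / of_nat (6 choose k)" for k
  have a: "a 0 = 0" "a 1 = 0" "a 2 \<noteq> 0" "a 4 \<noteq> 0" "a 5 = 0" "a 6 = 0"
    using assms by (simp_all add: a_def eval_nat_numeral)
  obtain g where g: "annihilates 6 P 3 g" "g \<noteq> 0"
    using waring_le_of_nondegenerate[of 3 P] neg by auto
  then have deg: "degree g \<le> 3" and eq: "\<And>j. j \<le> 3 \<Longrightarrow> coeff g 0 * a j + coeff g 1 * a (j + 1)
        + coeff g 2 * a (j + 2) + coeff g 3 * a (j + 3) = 0"
    by (simp_all add: annihilates_sextic_3[OF a_def])
  have e: "coeff g 2 * a 2 + coeff g 3 * a 3 = 0"
    "coeff g 1 * a 2 + coeff g 2 * a 3 + coeff g 3 * a 4 = 0"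
    "coeff g 0 * a 2 + coeff g 1 * a 3 + coeff g 2 * a 4 = 0"
    "coeff g 0 * a 3 + coeff g 1 * a 4 = 0"
    using eq[of 0] eq[of 1] eq[of 2] eq[of 3] a by (simp_all add: eval_nat_numeral)
  have g3: "coeff g 3 \<noteq> 0"
  proof
    assume g3: "coeff g 3 = 0"
    then have g2: "coeff g 2 = 0" using e(1) a(3) by simp
    then have g1: "coeff g 1 = 0" using e(2) a(3) g3 by simp
    then have "coeff g 0 = 0" using e(3) a(3) g2 by simp
    then show False using poly_eq_0_of_coeffs[of g 3] deg g1 g2 g3 g(2) by (auto simp: le_3_iff)
  qed
  then have deg3: "degree g = 3" using deg by (simp add: le_antisym le_degree)
  have "rsquarefree g"
    unfolding rsquarefree_roots
  proof (intro allI notI, elim conjE)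
    fix v assume v: "poly g v = 0" "poly (pderiv g) v = 0"
    have v1: "coeff g 0 + coeff g 1 * v + coeff g 2 * v ^ 2 + coeff g 3 * v ^ 3 = 0"
      using v(1) deg3 by (simp add: poly_altdef numeral_3_eq_3 numeral_2_eq_2)
    have v2: "coeff g 1 + 2 * coeff g 2 * v + 3 * coeff g 3 * v ^ 2 = 0"
    proof -
      have "degree (pderiv g) = 2" using deg3 by (simp add: degree_pderiv)
      then show ?thesis using v(2) by (simp add: poly_altdef coeff_pderiv numeral_3_eq_3 numeral_2_eq_2)
    qed
    \<comment> \<open>The first three equations express g by its top coefficient with powers of a 2
      as denominators. Rescaling the root to w clears them and leaves only a 3 and q as
      parameters.\<close>
    define w q where "w = a 2 * v" and "q = a 2 * a 4"
    have g2: "a 2 * coeff g 2 = - coeff g 3 * a 3" using e(1) by algebra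
    have g1: "a 2 ^ 2 * coeff g 1 = coeff g 3 * (a 3 ^ 2 - q)"
      unfolding q_def using e(2) g2 by algebra
    have g0: "a 2 ^ 3 * coeff g 0 = coeff g 3 * (2 * a 3 * q - a 3 ^ 3)"
      unfolding q_def using e(3) g1 g2 unfolding q_def by algebra
    have "coeff g 3 * (w ^ 3 - a 3 * w ^ 2 + (a 3 ^ 2 - q) * w + 2 * a 3 * q - a 3 ^ 3)
        = a 2 ^ 3 * (coeff g 0 + coeff g 1 * v + coeff g 2 * v ^ 2 + coeff g 3 * v ^ 3)"
      unfolding w_def using g0 g1 g2 by algebra
    then have w1: "w ^ 3 - a 3 * w ^ 2 + (a 3 ^ 2 - q) * w + 2 * a 3 * q - a 3 ^ 3 = 0"
      using v1 g3 by simp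
    have "coeff g 3 * (3 * w ^ 2 - 2 * a 3 * w + a 3 ^ 2 - q)
        = a 2 ^ 2 * (coeff g 1 + 2 * coeff g 2 * v + 3 * coeff g 3 * v ^ 2)"
      unfolding w_def using g1 g2 by algebra
    then have w2: "3 * w ^ 2 - 2 * a 3 * w + a 3 ^ 2 - q = 0" using v2 g3 by simp
    have "coeff g 3 * (a 3 ^ 4 - 3 * q * a 3 ^ 2 + q ^ 2)
        = - (a 2 ^ 3 * (coeff g 0 * a 3 + coeff g 1 * a 4))"
      using g0 g1 unfolding q_def by algebra
    then have w3: "a 3 ^ 4 - 3 * q * a 3 ^ 2 + q ^ 2 = 0" using e(4) g3 by simp
    \<comment> \<open>A double root of the cubic in w, together with the fourth equation (vanishing
      of the catalecticant determinant), leaves only q = 0.\<close>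
    from w1 w2 w3 have "q = 0" by algebra
    then show False using a(3,4) by (simp add: q_def)
  qed
  then have "waring_le 6 3 (hom 6 P)"
    using g(1) deg3 by (intro waring_le_of_rsquarefree_annihilator) auto
  then show False using neg waring_le_mono by force
qed

text \<open>The three double roots leave only multiples of (x y (x - y))^2, and the catalecticant of
  this single form is invertible.\<close>

lemma three_double_roots_bound:
  assumes "coeff P 0 = 0" "coeff P 1 = 0" "coeff P 2 \<noteq> 0" "coeff P 5 = 0" "coeff P 6 = 0"
    and "degree P \<le> 6" "[:- 1, 1:] ^ 2 dvd P" and "r \<le> 3"
  shows "\<not> waring_le 6 r (hom 6 P)"
proof (rule not_waring_le_of_no_annihilator[of _ _ 3])
  define a where "a k = coeff P k / of_nat (6 choose k)" for k
  obtain Q where Q: "P = [:- 1, 1:] ^ 2 * Q" using assms(7) by (auto elim: dvdE)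
  have "poly P 1 = 0" by (simp add: Q)
  then have P1: "coeff P 2 + coeff P 3 + coeff P 4 = 0"
    using assms by (simp add: poly_eq_sum_atMost[OF assms(6)] eval_nat_numeral)
  have "poly (pderiv P) 1 = 0" by (simp add: Q pderiv_mult pderiv_power)
  moreover have "degree (pderiv P) \<le> 5" using assms(6) by (simp add: degree_pderiv)
  ultimately have P1': "2 * coeff P 2 + 3 * coeff P 3 + 4 * coeff P 4 = 0"
    using assms by (simp add: poly_eq_sum_atMost[of _ 5] coeff_pderiv eval_nat_numeral)
  have c: "coeff P 3 = - 2 * coeff P 2" "coeff P 4 = coeff P 2" using P1 P1' by algebra+
  \<comment> \<open>The coefficients 1, -2, 1 of the middle terms are divided by 15, 20, 15; the
    factor 30 makes the quotients 2, -3, 2 times c.\<close>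
  define c where "c = coeff P 2 / 30"
  have a: "a 0 = 0" "a 1 = 0" "a 2 = 2 * c" "a 3 = - 3 * c" "a 4 = 2 * c" "a 5 = 0" "a 6 = 0" "c \<noteq> 0"
    using assms c by (simp_all add: a_def c_def eval_nat_numeral)
  fix g assume "annihilates 6 P 3 g"
  then have deg: "degree g \<le> 3" and eq: "\<And>j. j \<le> 3 \<Longrightarrow> coeff g 0 * a j + coeff g 1 * a (j + 1)
        + coeff g 2 * a (j + 2) + coeff g 3 * a (j + 3) = 0"
    by (simp_all add: annihilates_sextic_3[OF a_def])
  have "c * (2 * coeff g 2 - 3 * coeff g 3) = 0"
    "c * (2 * coeff g 1 - 3 * coeff g 2 + 2 * coeff g 3) = 0"
    "c * (2 * coeff g 0 - 3 * coeff g 1 + 2 * coeff g 2) = 0"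
    "c * (2 * coeff g 1 - 3 * coeff g 0) = 0"
    using eq[of 0] eq[of 1] eq[of 2] eq[of 3] a by (simp_all add: eval_nat_numeral algebra_simps)
  then have "2 * coeff g 2 = 3 * coeff g 3" "2 * coeff g 1 - 3 * coeff g 2 + 2 * coeff g 3 = 0"
    "2 * coeff g 0 - 3 * coeff g 1 + 2 * coeff g 2 = 0" "2 * coeff g 1 = 3 * coeff g 0"
    using a(8) by simp_all
  then have "coeff g 0 = 0" "coeff g 1 = 0" "coeff g 2 = 0" "coeff g 3 = 0" by algebra+
  then show "g = 0" using deg by (intro poly_eq_0_of_coeffs[of g 3]) (auto simp: le_3_iff)
qed (use assms in auto)

text \<open>
  The points \<open>b i / a i\<close> together with \<open>0\<close> are at most five roots of a monic quintic \<open>p\<close> without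
  constant term; pairing with \<open>p\<close> isolates the coefficient of \<open>x y\<^sup>5\<close>.
\<close>

lemma not_waring_le_4:
  assumes "\<And>k. 1 \<le> k \<Longrightarrow> k \<le> 4 \<Longrightarrow> coeff P k = 0" "coeff P 5 \<noteq> 0" "r \<le> 4"
  shows "\<not> waring_le 6 r (hom 6 P)"
proof
  assume "waring_le 6 r (hom 6 P)"
  then have "waring_le 6 4 (hom 6 P)" using assms(3) by (rule waring_le_mono) simp
  then obtain a b where ab: "\<And>x y. hom 6 P x y = (\<Sum>i<(4::nat). 1 * (a i * x + b i * y) ^ 6)"
    by (auto simp: waring_le_def)
  \<comment> \<open>For a i = 0 the quotient is 0 by convention. Such a point is at infinity, where
    the sextic homogenization of the quintic p vanishes anyway.\<close>
  define q where "q = (\<Prod>i<(4::nat). [:- (b i / a i), 1:])"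
  define p where "p = [:0, 1:] * q"
  have "degree q = 4" by (simp add: q_def degree_prod_sum_eq)
  moreover have "lead_coeff q = 1" by (simp add: q_def lead_coeff_prod)
  ultimately have p: "coeff p 0 = 0" "coeff p 5 = 1" "coeff p 6 = 0" "degree p \<le> 6"
    by (auto simp: p_def coeff_eq_0 eval_nat_numeral)
  \<comment> \<open>The outer terms drop out because p has neither a constant term nor a term of
    degree 6; those for 1 to 4 vanish with P.\<close>
  have "apolar 6 P p = coeff P 5 / 6"
    using assms(1)[of 1] assms(1)[of 2] assms(1)[of 3] assms(1)[of 4] p
    by (simp add: apolar_def eval_nat_numeral)
  moreover have "hom 6 p (a i) (b i) = 0" if "i < 4" for i
  proof (cases "a i = 0")
    case False
    have "poly q (b i / a i) = 0" unfolding q_def poly_prod using that by (intro prod_zero) auto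
    then show ?thesis using hom_nonzero_left[OF p(4) False] by (simp add: p_def)
  qed (simp add: hom_zero_left p)
  then have "apolar 6 P p = 0" by (simp add: apolar_power_sum[OF ab])
  ultimately show False using assms(2) by simp
qed

subsection \<open>Rank bounds from the root multiplicities\<close>

lemma coeff_hom_swap:
  assumes "\<And>x y. hom d Q x y = hom d P y x" "k \<le> d"
  shows "coeff Q k = coeff P (d - k)"
proof -
  have "(\<Sum>k\<le>d. coeff Q k * y ^ k) = (\<Sum>k\<le>d. coeff P (d - k) * y ^ k)" for y
  proof -
    have "(\<Sum>k\<le>d. coeff Q k * y ^ k) = (\<Sum>k\<le>d. coeff P k * y ^ (d - k))"
      using assms(1)[of 1 y] by (simp add: hom_def)
    also have "\<dots> = (\<Sum>k\<le>d. coeff P (d - k) * y ^ k)"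
      by (rule sum.reindex_bij_witness[of _ "\<lambda>k. d - k" "\<lambda>k. d - k"]) auto
    finally show ?thesis .
  qed
  then show ?thesis using polyfun_eq_coeffs[of "coeff Q" d "\<lambda>k. coeff P (d - k)"] assms(2) by blast
qed

text \<open>Passes to coordinates adapted to two chosen points: rank and the absence of triple
  factors survive any invertible substitution.\<close>

lemma sextic_coordinates:
  assumes "sextic_mult_le_2 f" "a * b' \<noteq> a' * b"
  obtains P where "degree P \<le> 6"
    "\<And>x y. form_eval f (a * x + a' * y) (b * x + b' * y) = hom 6 P x y"
    "\<And>r. waring_le 6 r (hom 6 P) \<longleftrightarrow> waring_le 6 r (form_eval f)"
    "\<not> has_cubic_factor P"
proof -
  obtain P0 where P0: "f = hom_poly 6 P0 var_x var_y"
    using assms(1) by (auto simp: sextic_mult_le_2_def elim: binary_form_imp_hom_poly)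
  obtain P where P: "degree P \<le> 6"
    "\<And>x y. hom 6 P0 (a * x + a' * y) (b * x + b' * y) = hom 6 P x y"
    using hom_subst_linear[of 6 P0 a a' b b'] by blast
  have eq: "form_eval f (a * x + a' * y) (b * x + b' * y) = hom 6 P x y" for x y
    by (simp add: P0 form_eval_hom_poly form_eval_simps P(2))
  show ?thesis
  proof
    show "degree P \<le> 6" by fact
    show "form_eval f (a * x + a' * y) (b * x + b' * y) = hom 6 P x y" for x y by fact
    show "waring_le 6 r (hom 6 P) \<longleftrightarrow> waring_le 6 r (form_eval f)" for r
      using waring_le_subst_iff[OF assms(2), of 6 r "form_eval f"] by (simp add: eq)
    show "\<not> has_cubic_factor P"
    proof
      assume "has_cubic_factor P"
      then obtain u v Q where uv: "(u, v) \<noteq> (0, 0)"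
        "\<And>x y. hom 6 P x y = (u * x + v * y) ^ 3 * hom 3 Q x y"
        unfolding has_cubic_factor_def by blast
      obtain A B where "(A, B) \<noteq> (0, 0)" "(scalar B * var_x - scalar A * var_y) ^ 3 dvd f"
        using dvd_homogenize[OF assms(2) uv(1), of f 3 3 Q] eq uv(2) by auto
      then show False using no_cubic_factor[OF assms(1)] by blast
    qed
  qed
qed

text \<open>The substitution sends [1 : 0] to [a : b], so a root of f there becomes a root of P at
  0.\<close>

lemma sextic_root_coeff:
  assumes "sextic_mult_le_2 f" "a * b' \<noteq> a' * b" "degree P \<le> 6"
    and "\<And>x y. form_eval f (a * x + a' * y) (b * x + b' * y) = hom 6 P x y"
    and "n \<le> root_mult f (proj_rel `` {(a, b)})" "k < n"
  shows "coeff P k = 0"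
proof -
  have "(scalar b * var_x - scalar a * var_y) ^ n dvd f"
    using assms by (subst linear_power_dvd_iff) (auto simp: sextic_mult_le_2_def)
  from dvd_dehomogenize[OF this assms(3,4)] have "[:0, b * a' - a * b':] ^ n dvd P" by (simp add: mult.commute)
  moreover have "[:0, b * a' - a * b':] ^ n = smult ((b * a' - a * b') ^ n) (monom 1 n)"
    using smult_power[of "b * a' - a * b'" "[:0, 1:]" n] by (simp add: monom_altdef)
  ultimately have "monom 1 n dvd P"
    using assms(2) by (simp add: smult_dvd_iff mult.commute)
  then show ?thesis using assms(6) by (simp add: monom_1_dvd_iff')
qed

lemma coeff_2_nonzero:
  assumes "\<not> has_cubic_factor P"
    and "degree P \<le> 6" "coeff P 0 = 0" "coeff P 1 = 0"
  shows "coeff P 2 \<noteq> 0"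
proof
  assume "coeff P 2 = 0"
  then have "monom 1 3 dvd P" using assms(3,4)
    by (auto simp: monom_1_dvd_iff' numeral_3_eq_3 numeral_2_eq_2 less_Suc_eq)
  then obtain Q where Q: "P = monom 1 3 * Q" by (auto elim: dvdE)
  have "degree Q \<le> 3"
  proof (cases "Q = 0")
    case False
    then show ?thesis using assms(2) unfolding Q by (simp add: degree_mult_eq degree_monom_eq)
  qed simp
  then have "hom (3 + 3) (monom 1 3 * Q) x y = hom 3 (monom 1 3) x y * hom 3 Q x y" for x y
    by (intro hom_mult) (simp_all add: degree_monom_eq)
  then have "hom 6 P x y = (0 * x + 1 * y) ^ 3 * hom 3 Q x y" for x y
    by (simp add: Q hom_monom)
  moreover have "(0 :: complex, 1 :: complex) \<noteq> (0, 0)" by simp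
  ultimately show False using assms(1) unfolding has_cubic_factor_def by blast
qed

lemma exists_independent_point:
  assumes "(a, b) \<noteq> (0 :: complex, 0)"
  obtains a' b' where "a * b' \<noteq> a' * b"
  using assms that[of 1 0] that[of 0 1] by auto

lemma sextic_rank_bounds:
  assumes "sextic_mult_le_2 f" "p \<in> roots f"
  shows "waring_le 6 5 (form_eval f)" and "r < 2 \<Longrightarrow> \<not> waring_le 6 r (form_eval f)"
proof -
  obtain a b where ab: "(a, b) \<noteq> (0, 0)" "p = proj_rel `` {(a, b)}"
    using assms(2) P1_cases by (auto simp: roots_def)
  obtain a' b' where ind: "a * b' \<noteq> a' * b" using exists_independent_point[OF ab(1)] .
  obtain P where P: "degree P \<le> 6"
    "\<And>x y. form_eval f (a * x + a' * y) (b * x + b' * y) = hom 6 P x y"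
    "\<And>r. waring_le 6 r (hom 6 P) \<longleftrightarrow> waring_le 6 r (form_eval f)"
    "\<not> has_cubic_factor P"
    using sextic_coordinates[OF assms(1) ind] by blast
  have c0: "coeff P 0 = 0"
    using sextic_root_coeff[OF assms(1) ind P(1,2), of 1 0] assms(2) by (simp add: ab(2) roots_def)
  have "waring_le 6 5 (hom 6 P) \<and> (r < 2 \<longrightarrow> \<not> waring_le 6 r (hom 6 P))"
  proof (cases "coeff P 1 = 0")
    case True
    then show ?thesis using double_root_bounds[OF c0 True] coeff_2_nonzero[OF P(4,1) c0 True] by simp
  next
    case False
    then show ?thesis using simple_root_bounds[OF c0 False P(4)] by blast
  qed
  then show "waring_le 6 5 (form_eval f)" "r < 2 \<Longrightarrow> \<not> waring_le 6 r (form_eval f)"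
    using P(3) by auto
qed

lemma double_root_coordinates:
  assumes "sextic_mult_le_2 f" "a * b' \<noteq> a' * b" "degree P \<le> 6"
    and "\<And>x y. form_eval f (a * x + a' * y) (b * x + b' * y) = hom 6 P x y"
    and "\<not> has_cubic_factor P"
    and "proj_rel `` {(a, b)} \<in> double_roots f"
  shows "coeff P 0 = 0" "coeff P 1 = 0" "coeff P 2 \<noteq> 0"
proof -
  show c: "coeff P 0 = 0" "coeff P 1 = 0"
    using sextic_root_coeff[OF assms(1-4), of 2] assms(6) by (simp_all add: double_roots_def)
  show "coeff P 2 \<noteq> 0" by (rule coeff_2_nonzero[OF assms(5,3) c])
qed

lemma sextic_double_root_rank_ge_3:
  assumes "sextic_mult_le_2 f" "p \<in> double_roots f" "r < 3"
  shows "\<not> waring_le 6 r (form_eval f)"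
proof -
  obtain a b where ab: "(a, b) \<noteq> (0, 0)" "p = proj_rel `` {(a, b)}"
    using assms(2) P1_cases by (auto simp: double_roots_def)
  obtain a' b' where ind: "a * b' \<noteq> a' * b" using exists_independent_point[OF ab(1)] .
  obtain P where P: "degree P \<le> 6"
    "\<And>x y. form_eval f (a * x + a' * y) (b * x + b' * y) = hom 6 P x y"
    "\<And>r. waring_le 6 r (hom 6 P) \<longleftrightarrow> waring_le 6 r (form_eval f)"
    "\<not> has_cubic_factor P"
    using sextic_coordinates[OF assms(1) ind] by blast
  show ?thesis
    using double_root_bounds(1)[OF double_root_coordinates[OF assms(1) ind P(1,2,4)]] assms(2,3) P(3)
    by (simp add: ab(2))
qed

lemma double_roots_subset_roots: "double_roots f \<subseteq> roots f"
  by (auto simp: double_roots_def roots_def)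

lemma two_double_roots_coordinates:
  assumes f: "sextic_mult_le_2 f" and ind: "a * b' \<noteq> a' * b"
    and dr: "proj_rel `` {(a, b)} \<in> double_roots f" "proj_rel `` {(a', b')} \<in> double_roots f"
  obtains P where "degree P \<le> 6"
    "\<And>x y. form_eval f (a * x + a' * y) (b * x + b' * y) = hom 6 P x y"
    "\<And>r. waring_le 6 r (hom 6 P) \<longleftrightarrow> waring_le 6 r (form_eval f)"
    "coeff P 0 = 0" "coeff P 1 = 0" "coeff P 2 \<noteq> 0" "coeff P 4 \<noteq> 0" "coeff P 5 = 0" "coeff P 6 = 0"
proof -
  obtain P where P: "degree P \<le> 6"
    "\<And>x y. form_eval f (a * x + a' * y) (b * x + b' * y) = hom 6 P x y"
    "\<And>r. waring_le 6 r (hom 6 P) \<longleftrightarrow> waring_le 6 r (form_eval f)"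
    "\<not> has_cubic_factor P"
    using sextic_coordinates[OF f ind] by blast
  have ind': "a' * b \<noteq> a * b'" using ind by simp
  \<comment> \<open>The same form with the two points exchanged. Its low coefficients are the top
    coefficients of P, so the second double root is read off like the first.\<close>
  obtain Q where Q: "degree Q \<le> 6"
    "\<And>x y. form_eval f (a' * x + a * y) (b' * x + b * y) = hom 6 Q x y"
    "\<And>r. waring_le 6 r (hom 6 Q) \<longleftrightarrow> waring_le 6 r (form_eval f)"
    "\<not> has_cubic_factor Q"
    using sextic_coordinates[OF f ind'] by blast
  have "hom 6 P x y = hom 6 Q y x" for x y
    using P(2)[of x y] Q(2)[of y x] by (simp add: add.commute)
  then have swap: "coeff P k = coeff Q (6 - k)" if "k \<le> 6" for k
    using coeff_hom_swap that by blast
  note dP = double_root_coordinates[OF f ind P(1,2,4) dr(1)]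
  note dQ = double_root_coordinates[OF f ind' Q(1,2,4) dr(2)]
  show ?thesis
    using that[OF P(1-3) dP] dQ swap[of 4] swap[of 5] swap[of 6] by simp
qed

lemma sextic_two_double_roots_rank_le_4:
  assumes "sextic_mult_le_2 f" "p \<in> double_roots f" "q \<in> double_roots f" "p \<noteq> q"
  shows "waring_le 6 4 (form_eval f)"
proof -
  obtain a b where ab: "(a, b) \<noteq> (0, 0)" "p = proj_rel `` {(a, b)}"
    using assms(2) P1_cases by (auto simp: double_roots_def)
  obtain a' b' where ab': "(a', b') \<noteq> (0, 0)" "q = proj_rel `` {(a', b')}"
    using assms(3) P1_cases by (auto simp: double_roots_def)
  have ind: "a * b' \<noteq> a' * b" using assms(4) proj_class_eq_iff[OF ab(1) ab'(1)] ab ab' by simp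
  show ?thesis
    using two_double_roots_coordinates[OF assms(1) ind] assms(2,3) two_double_roots_bound
    unfolding ab(2) ab'(2) by metis
qed

lemma sextic_three_double_roots_rank_ge_4:
  assumes f: "sextic_mult_le_2 f" and dr: "p \<in> double_roots f" "q \<in> double_roots f" "s \<in> double_roots f"
    and neq: "p \<noteq> q" "p \<noteq> s" "q \<noteq> s" and r: "r < 4"
  shows "\<not> waring_le 6 r (form_eval f)"
proof -
  obtain a0 b0 where ab0: "(a0, b0) \<noteq> (0, 0)" "p = proj_rel `` {(a0, b0)}"
    using dr(1) P1_cases by (auto simp: double_roots_def)
  obtain a1 b1 where ab1: "(a1, b1) \<noteq> (0, 0)" "q = proj_rel `` {(a1, b1)}"
    using dr(2) P1_cases by (auto simp: double_roots_def)
  obtain A B where AB: "(A, B) \<noteq> (0, 0)" "s = proj_rel `` {(A, B)}"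
    using dr(3) P1_cases by (auto simp: double_roots_def)
  define D where "D = a0 * b1 - a1 * b0"
  have D: "D \<noteq> 0" using neq(1) proj_class_eq_iff[OF ab0(1) ab1(1)] ab0 ab1 by (simp add: D_def)
  \<comment> \<open>Rescale the representatives of the first two points so that they add up to the third.\<close>
  define u where "u = (A * b1 - a1 * B) / D"
  define v where "v = (a0 * B - A * b0) / D"
  have u: "u \<noteq> 0" using neq(3) proj_class_eq_iff[OF ab1(1) AB(1)] ab1 AB D
    by (auto simp: u_def)
  have v: "v \<noteq> 0" using neq(2) proj_class_eq_iff[OF ab0(1) AB(1)] ab0 AB D
    by (auto simp: v_def)
  define a b a' b' where "a = u * a0" and "b = u * b0" and "a' = v * a1" and "b' = v * b1"
  have sum: "a + a' = A" "b + b' = B"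
  proof -
    have "D * (a + a') = D * A" "D * (b + b') = D * B"
      using D unfolding a_def b_def a'_def b'_def u_def v_def
      by (simp_all add: field_simps) (simp_all add: D_def algebra_simps)
    then show "a + a' = A" "b + b' = B" using D by simp_all
  qed
  have p: "p = proj_rel `` {(a, b)}" and q: "q = proj_rel `` {(a', b')}"
    using ab0 ab1 u v unfolding a_def b_def a'_def b'_def by (auto simp: proj_class_eq_iff)
  have det: "a * b' - a' * b = u * v * D" by (simp add: a_def b_def a'_def b'_def D_def algebra_simps)
  then have ind: "a * b' \<noteq> a' * b" using u v D by auto
  obtain P where P: "degree P \<le> 6"
    "\<And>x y. form_eval f (a * x + a' * y) (b * x + b' * y) = hom 6 P x y"
    "\<And>r. waring_le 6 r (hom 6 P) \<longleftrightarrow> waring_le 6 r (form_eval f)"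
    "coeff P 0 = 0" "coeff P 1 = 0" "coeff P 2 \<noteq> 0" "coeff P 4 \<noteq> 0" "coeff P 5 = 0" "coeff P 6 = 0"
    using two_double_roots_coordinates[OF f ind] dr(1,2) unfolding p q by metis
  have "(scalar B * var_x - scalar A * var_y) ^ 2 dvd f"
    using f dr(3) AB by (subst linear_power_dvd_iff) (auto simp: sextic_mult_le_2_def double_roots_def)
  \<comment> \<open>Because the representatives add up to (A, B), the third point is [1 : 1] in the
    new coordinates, hence the root 1 of P.\<close>
  from dvd_dehomogenize[OF this P(1,2)]
  have "[:B * a - A * b, B * a' - A * b':] ^ 2 dvd P" .
  moreover have "[:B * a - A * b, B * a' - A * b':] = smult (- (u * v * D)) [:- 1, 1:]"
    unfolding det[symmetric] sum[symmetric] by (simp add: algebra_simps)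
  ultimately have "[:- 1, 1:] ^ 2 dvd P"
    using u v D by (simp only: smult_power smult_dvd_iff) simp
  then have "\<not> waring_le 6 r (hom 6 P)"
    using r P(1,4-6,8,9) by (intro three_double_roots_bound) auto
  then show ?thesis using P(3) by simp
qed

lemma form_eval_hom_poly_var: "form_eval (hom_poly d P var_x var_y) = hom d P"
  by (simp add: fun_eq_iff form_eval_hom_poly form_eval_simps)

lemma waring_rank_eqI:
  assumes "waring_le d r (form_eval f)" "\<And>s. s < r \<Longrightarrow> \<not> waring_le d s (form_eval f)"
  shows "waring_rank d f = r"
  using waring_rank_le[OF assms(1)] waring_rank_ge[OF assms] by (rule order.antisym)

subsection \<open>Sextics attaining the ranks\<close>

lemma hom_6:
  "hom 6 P x y = coeff P 0 * x ^ 6 + coeff P 1 * x ^ 5 * y + coeff P 2 * x ^ 4 * y ^ 2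
    + coeff P 3 * x ^ 3 * y ^ 3 + coeff P 4 * x ^ 2 * y ^ 4 + coeff P 5 * x * y ^ 5 + coeff P 6 * y ^ 6"
  by (simp add: hom_def eval_nat_numeral)

text \<open>An invertible catalecticant bounds the rank from both sides: no three powers suffice,
  and a pencil of quartics supplies four.\<close>

lemma sextic_waring_rank_4_of_nondegenerate:
  assumes "\<And>k. k \<le> 6 \<Longrightarrow> a k = coeff P k / of_nat (6 choose k)"
    and "\<And>g :: nat \<Rightarrow> complex. (\<And>j. j \<le> 3 \<Longrightarrow>
      g 0 * a j + g 1 * a (j + 1) + g 2 * a (j + 2) + g 3 * a (j + 3) = 0) \<Longrightarrow>
      g 0 = 0 \<and> g 1 = 0 \<and> g 2 = 0 \<and> g 3 = 0"
  shows "waring_rank 6 (hom_poly 6 P var_x var_y) = 4"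
proof -
  have nondeg: "g = 0" if "annihilates 6 P 3 g" for g
  proof -
    have "coeff g 0 = 0 \<and> coeff g 1 = 0 \<and> coeff g 2 = 0 \<and> coeff g 3 = 0"
      using that by (intro assms(2)) (simp add: annihilates_sextic_3[OF assms(1)])
    then show ?thesis
      using that by (intro poly_eq_0_of_coeffs[of g 3]) (auto simp: le_3_iff annihilates_def)
  qed
  show ?thesis
  proof (rule waring_rank_eqI)
    show "waring_le 6 4 (form_eval (hom_poly 6 P var_x var_y))"
      using waring_le_of_nondegenerate[of 3 P] nondeg by (simp add: form_eval_hom_poly_var)
    show "\<not> waring_le 6 s (form_eval (hom_poly 6 P var_x var_y))" if "s < 4" for s
      unfolding form_eval_hom_poly_var
      using that by (intro not_waring_le_of_no_annihilator[of _ _ 3] nondeg) auto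
  qed
qed

lemma waring_rank_3_of_double_root:
  assumes "sextic_mult_le_2 f" "card (double_roots f) \<noteq> 0" "waring_le 6 3 (form_eval f)"
  shows "waring_rank 6 f = 3"
proof (rule waring_rank_eqI[OF assms(3)])
  obtain p where "p \<in> double_roots f" using assms(2) by (auto simp: card_eq_0_iff)
  then show "\<not> waring_le 6 s (form_eval f)" if "s < 3" for s
    using sextic_double_root_rank_ge_3[OF assms(1)] that by blast
qed

text \<open>These are the forms c x^6 + y^5 l with l a linear form not proportional to y.\<close>

lemma waring_rank_5_of_pure_coeffs:
  assumes "degree P = 6" "\<And>k. 1 \<le> k \<Longrightarrow> k \<le> 4 \<Longrightarrow> coeff P k = 0" "coeff P 5 \<noteq> 0"
    and f: "f = hom_poly 6 P var_x var_y" "sextic_mult_le_2 f" "card (roots f) \<noteq> 0"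
  shows "waring_rank 6 f = 5"
proof (rule waring_rank_eqI)
  obtain p where "p \<in> roots f" using f(3) by (auto simp: card_eq_0_iff)
  then show "waring_le 6 5 (form_eval f)" using sextic_rank_bounds(1)[OF f(2)] by blast
  show "\<not> waring_le 6 s (form_eval f)" if "s < 5" for s
    using that not_waring_le_4[OF assms(2,3)] by (simp add: f(1) form_eval_hom_poly_var)
qed

text \<open>The form is half of (x + y)^6 + (x - y)^6 plus (b - 1) y^6. It is even in v, so one
  double root brings its negative along, and only b remains to be tuned. Eliminating b from the
  cubic in S and its derivative gives 5 S^2 + 10 S + 1 = 0, whence the square root of 5.\<close>

lemma rank_3_two_double_roots:
  "\<exists>f. sextic_mult_le_2 f \<and> card (double_roots f) = 2 \<and> waring_rank 6 f = 3"
proof -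
  obtain z :: complex where z: "z ^ 2 = 5" using nth_root_exists[of 2 5] by auto
  define s where "s = 2 * z / 5 - 1"
  have s: "5 * s ^ 2 + 10 * s + 1 = 0"
    using z by (simp add: s_def power2_eq_square field_simps)
  have s0: "s \<noteq> 0" using s by auto
  \<comment> \<open>The cubic \<open>1 + 15 S + 15 S\<^sup>2 + b S\<^sup>3\<close> in \<open>S = v\<^sup>2\<close> gets the double root \<open>s\<close>.\<close>
  define b where "b = - (5 + 10 * s) / s ^ 2"
  have bs: "b * s ^ 2 = - (5 + 10 * s)" using s0 by (simp add: b_def)
  have b0: "b \<noteq> 0"
  proof
    assume "b = 0"
    then have "0 * s ^ 2 = - (5 + 10 * s)" using bs by (simp only:)
    then show False using s by algebra
  qed
  let ?P = "[:1, 0, 15, 0, 15, 0, b:]"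
  have val: "poly ?P v = 1 + 15 * v ^ 2 + 15 * v ^ 4 + b * v ^ 6"
    "poly (pderiv ?P) v = 30 * v + 60 * v ^ 3 + 6 * b * v ^ 5"
    "poly (pderiv (pderiv ?P)) v = 30 + 180 * v ^ 2 + 30 * b * v ^ 4" for v
    by (simp_all add: pderiv_pCons algebra_simps eval_nat_numeral)
  have double: "5 * (v ^ 2) ^ 2 + 10 * v ^ 2 + 1 = 0 \<and> b * (v ^ 2) ^ 2 = - (5 + 10 * v ^ 2)"
    if "poly ?P v = 0" "poly (pderiv ?P) v = 0" for v
  proof -
    have "v \<noteq> 0" using that(1) by auto
    moreover have "6 * v * (5 + 10 * v ^ 2 + b * (v ^ 2) ^ 2) = 0"
      using that(2) unfolding val by algebra
    ultimately have "5 + 10 * v ^ 2 + b * (v ^ 2) ^ 2 = 0" by simp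
    then show ?thesis using that(1) unfolding val by algebra
  qed
  have triple: "\<not> (poly ?P v = 0 \<and> poly (pderiv ?P) v = 0 \<and> poly (pderiv (pderiv ?P)) v = 0)" for v
  proof (intro notI, elim conjE)
    assume *: "poly ?P v = 0" "poly (pderiv ?P) v = 0" "poly (pderiv (pderiv ?P)) v = 0"
    show False using double[OF *(1,2)] *(3) unfolding val by algebra
  qed
  obtain w where w: "w ^ 2 = s" using nth_root_exists[of 2 s] by auto
  have "{v. poly ?P v = 0 \<and> poly (pderiv ?P) v = 0} = {w, - w}"
  proof (intro equalityI subsetI)
    fix v assume "v \<in> {v. poly ?P v = 0 \<and> poly (pderiv ?P) v = 0}"
    then have d: "5 * (v ^ 2) ^ 2 + 10 * v ^ 2 + 1 = 0" "b * (v ^ 2) ^ 2 = - (5 + 10 * v ^ 2)"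
      using double by auto
    have "(v ^ 2 - s) * (v ^ 2 + s + 2) = 0" using d(1) s by algebra
    \<comment> \<open>The other zero of the quadratic is - 2 - s; it would require a different value
      of b.\<close>
    moreover have "v ^ 2 + s + 2 \<noteq> 0"
    proof
      assume "v ^ 2 + s + 2 = 0"
      then have v: "v ^ 2 = - 2 - s" by algebra
      have "s ^ 2 * (5 + 10 * (- 2 - s)) = (- 2 - s) ^ 2 * (5 + 10 * s)"
        using d(2) bs unfolding v by algebra
      then show False using s by algebra
    qed
    ultimately have "v ^ 2 = w ^ 2" using w by simp
    then show "v \<in> {w, - w}" by (simp add: power2_eq_iff)
  next
    fix v assume "v \<in> {w, - w}"
    then have v: "v ^ 2 = s" using w by auto
    have "1 + 15 * v ^ 2 + 15 * v ^ 4 + b * v ^ 6 = 1 + 15 * s + 15 * s ^ 2 + s * (b * s ^ 2)"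
      unfolding v[symmetric] by algebra
    also have "\<dots> = 0" unfolding bs using s by algebra
    finally have "1 + 15 * v ^ 2 + 15 * v ^ 4 + b * v ^ 6 = 0" .
    moreover have "30 * v + 60 * v ^ 3 + 6 * b * v ^ 5 = v * (30 + 60 * s + 6 * (b * s ^ 2))"
      unfolding v[symmetric] by algebra
    then have "30 * v + 60 * v ^ 3 + 6 * b * v ^ 5 = 0" unfolding bs by simp
    ultimately show "v \<in> {v. poly ?P v = 0 \<and> poly (pderiv ?P) v = 0}" by (simp only: val mem_Collect_eq)
  qed
  moreover have "w \<noteq> - w" using w s0 by auto
  ultimately have card: "card {v. poly ?P v = 0 \<and> poly (pderiv ?P) v = 0} = 2" by simp
  let ?f = "hom_poly 6 ?P var_x var_y"
  have deg: "degree ?P = 6" using b0 by simp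
  note f = sextic_form(1,2)[OF deg triple, unfolded card]
  have "hom 6 ?P x y = (\<Sum>i<(3::nat). [1 / 2, 1 / 2, b - 1] ! i * ([1, 1, 0] ! i * x + [1, - 1, 1] ! i * y) ^ 6)"
    for x y
    unfolding hom_6 by (simp add: eval_nat_numeral field_simps)
  then have "waring_le 6 3 (hom 6 ?P)" by (rule waring_le_of_power_sum[rotated 3]) auto
  then have "waring_rank 6 ?f = 3"
    using f by (intro waring_rank_3_of_double_root) (auto simp: form_eval_hom_poly_var)
  then show ?thesis using f by blast
qed

text \<open>The polynomial is (v^2 - 1)^2 (v^2 + 1); being even, it splits the catalecticant into
  two small systems.\<close>

lemma rank_4_two_double_roots:
  "\<exists>f. sextic_mult_le_2 f \<and> card (double_roots f) = 2 \<and> waring_rank 6 f = 4"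
proof -
  let ?P = "[:1, 0, - 1, 0, - 1, 0, 1 :: complex:]"
  have val: "poly ?P v = (v ^ 2 - 1) ^ 2 * (v ^ 2 + 1)"
    "poly (pderiv ?P) v = 2 * v * (v ^ 2 - 1) * (3 * v ^ 2 + 1)"
    "poly (pderiv (pderiv ?P)) v = 30 * v ^ 4 - 12 * v ^ 2 - 2" for v
    by (simp_all add: pderiv_pCons algebra_simps eval_nat_numeral)
  have double: "v ^ 2 = 1" if v: "poly ?P v = 0" "poly (pderiv ?P) v = 0" for v
  proof (rule ccontr)
    assume "v ^ 2 \<noteq> 1"
    then have e: "v ^ 2 = - 1" "v = 0 \<or> 3 * v ^ 2 + 1 = 0"
      using v unfolding val by (simp_all add: eq_neg_iff_add_eq_0)
    then show False by (elim disjE) simp_all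
  qed
  have triple: "\<not> (poly ?P v = 0 \<and> poly (pderiv ?P) v = 0 \<and> poly (pderiv (pderiv ?P)) v = 0)" for v
  proof (intro notI, elim conjE)
    assume *: "poly ?P v = 0" "poly (pderiv ?P) v = 0" "poly (pderiv (pderiv ?P)) v = 0"
    show False using double[OF *(1,2)] *(3) unfolding val by algebra
  qed
  have "{v. poly ?P v = 0 \<and> poly (pderiv ?P) v = 0} = {1, - 1}"
  proof (intro equalityI subsetI)
    fix v assume "v \<in> {v. poly ?P v = 0 \<and> poly (pderiv ?P) v = 0}"
    then have "v ^ 2 = 1" using double by blast
    then show "v \<in> {1, - 1}" by (simp add: power2_eq_1_iff)
  qed (auto simp: val)
  then have card: "card {v. poly ?P v = 0 \<and> poly (pderiv ?P) v = 0} = 2" by simp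
  let ?f = "hom_poly 6 ?P var_x var_y"
  have deg: "degree ?P = 6" by simp
  note f = sextic_form(1,2)[OF deg triple, unfolded card]
  have "waring_rank 6 ?f = 4"
  proof (rule sextic_waring_rank_4_of_nondegenerate[OF refl])
    fix g :: "nat \<Rightarrow> complex"
    assume *: "\<And>j. j \<le> 3 \<Longrightarrow> g 0 * (coeff ?P j / of_nat (6 choose j))
      + g 1 * (coeff ?P (j + 1) / of_nat (6 choose (j + 1)))
      + g 2 * (coeff ?P (j + 2) / of_nat (6 choose (j + 2)))
      + g 3 * (coeff ?P (j + 3) / of_nat (6 choose (j + 3))) = 0"
    have "15 * g 0 - g 2 = 0" "g 1 + g 3 = 0" "g 0 + g 2 = 0" "15 * g 3 - g 1 = 0"
      using *[of 0] *[of 1] *[of 2] *[of 3]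
      by (simp_all add: eval_nat_numeral field_simps add_eq_0_iff)
    then show "g 0 = 0 \<and> g 1 = 0 \<and> g 2 = 0 \<and> g 3 = 0" by algebra
  qed
  then show ?thesis using f by blast
qed

text \<open>The form is (x + y)^6 - 32 x^6 - 32 y^6; the weight 32 makes value and derivative vanish
  at v = 1.\<close>

lemma rank_3_one_double_root:
  "\<exists>f. sextic_mult_le_2 f \<and> card (double_roots f) = 1 \<and> waring_rank 6 f = 3"
proof -
  let ?P = "[:- 31, 6, 15, 20, 15, 6, - 31 :: complex:]"
  have val: "poly ?P v = (v + 1) ^ 6 - 32 - 32 * v ^ 6"
    "poly (pderiv ?P) v = 6 * (v + 1) ^ 5 - 192 * v ^ 5"
    "poly (pderiv (pderiv ?P)) v = 30 * (v + 1) ^ 4 - 960 * v ^ 4" for v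
    by (simp_all add: pderiv_pCons algebra_simps eval_nat_numeral)
  have double: "v = 1" if v: "poly ?P v = 0" "poly (pderiv ?P) v = 0" for v
  proof (rule ccontr)
    assume "v \<noteq> 1"
    have d: "(v + 1) ^ 5 = 32 * v ^ 5" using v(2) unfolding val by simp
    have "(v + 1) * (v + 1) ^ 5 = 32 + 32 * v ^ 6" using v(1) unfolding val by algebra
    then have "(v + 1) * (32 * v ^ 5) = 32 + 32 * v ^ 6" unfolding d .
    then have v5: "v ^ 5 = 1" by algebra
    then have "(v - 1) * (v ^ 4 + v ^ 3 + v ^ 2 + v + 1) = 0" by algebra
    then have "v ^ 4 + v ^ 3 + v ^ 2 + v + 1 = 0" using \<open>v \<noteq> 1\<close> by simp
    \<comment> \<open>Expanding (v + 1)^5 = 32 and subtracting five times the vanishing sum of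
      powers of v gives this. Its fifth power contradicts (v + 1)^5 = 32, as v^5 = 1.\<close>
    then have "v ^ 2 * (v + 1) = 7" using d v5 by algebra
    moreover have "(v ^ 5) ^ 2 * (v + 1) ^ 5 = (v ^ 2 * (v + 1)) ^ 5"
      by (simp add: power_mult_distrib power_mult[symmetric])
    ultimately have "(v ^ 5) ^ 2 * (v + 1) ^ 5 = 7 ^ 5" by simp
    then show False using d v5 by simp
  qed
  have triple: "\<not> (poly ?P v = 0 \<and> poly (pderiv ?P) v = 0 \<and> poly (pderiv (pderiv ?P)) v = 0)" for v
  proof (intro notI, elim conjE)
    assume *: "poly ?P v = 0" "poly (pderiv ?P) v = 0" "poly (pderiv (pderiv ?P)) v = 0"
    show False using double[OF *(1,2)] *(3) unfolding val by simp
  qed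
  have "{v. poly ?P v = 0 \<and> poly (pderiv ?P) v = 0} = {1}"
  proof (intro equalityI subsetI)
    fix v assume "v \<in> {v. poly ?P v = 0 \<and> poly (pderiv ?P) v = 0}"
    then show "v \<in> {1}" using double by blast
  qed (auto simp: val)
  then have card: "card {v. poly ?P v = 0 \<and> poly (pderiv ?P) v = 0} = 1" by simp
  let ?f = "hom_poly 6 ?P var_x var_y"
  have deg: "degree ?P = 6" by simp
  note f = sextic_form(1,2)[OF deg triple, unfolded card]
  have "hom 6 ?P x y = (\<Sum>i<(3::nat). [1, - 32, - 32] ! i * ([1, 1, 0] ! i * x + [1, 0, 1] ! i * y) ^ 6)"
    for x y
    unfolding hom_6 by (simp add: eval_nat_numeral) algebra
  then have "waring_le 6 3 (hom 6 ?P)" by (rule waring_le_of_power_sum[rotated 3]) auto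
  then have "waring_rank 6 ?f = 3"
    using f by (intro waring_rank_3_of_double_root) (auto simp: form_eval_hom_poly_var)
  then show ?thesis using f by blast
qed

lemma rank_4_one_double_root:
  "\<exists>f. sextic_mult_le_2 f \<and> card (double_roots f) = 1 \<and> waring_rank 6 f = 4"
proof -
  let ?P = "[:0, 0, 1, 0, 0, 0, 1 :: complex:]"
  have val: "poly ?P v = v ^ 2 + v ^ 6" "poly (pderiv ?P) v = 2 * v + 6 * v ^ 5"
    "poly (pderiv (pderiv ?P)) v = 2 + 30 * v ^ 4" for v
    by (simp_all add: pderiv_pCons algebra_simps eval_nat_numeral)
  have double: "v = 0" if "poly ?P v = 0" "poly (pderiv ?P) v = 0" for v
  proof -
    have "2 * v ^ 2 = 3 * (v ^ 2 + v ^ 6) - v / 2 * (2 * v + 6 * v ^ 5)"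
      by (simp add: field_simps eval_nat_numeral)
    then show ?thesis using that unfolding val by simp
  qed
  have triple: "\<not> (poly ?P v = 0 \<and> poly (pderiv ?P) v = 0 \<and> poly (pderiv (pderiv ?P)) v = 0)" for v
  proof (intro notI, elim conjE)
    assume *: "poly ?P v = 0" "poly (pderiv ?P) v = 0" "poly (pderiv (pderiv ?P)) v = 0"
    show False using double[OF *(1,2)] *(3) unfolding val by simp
  qed
  have "{v. poly ?P v = 0 \<and> poly (pderiv ?P) v = 0} = {0}"
  proof (intro equalityI subsetI)
    fix v assume "v \<in> {v. poly ?P v = 0 \<and> poly (pderiv ?P) v = 0}"
    then show "v \<in> {0}" using double by blast
  qed (auto simp: val)
  then have card: "card {v. poly ?P v = 0 \<and> poly (pderiv ?P) v = 0} = 1" by simp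
  let ?f = "hom_poly 6 ?P var_x var_y"
  have deg: "degree ?P = 6" by simp
  note f = sextic_form(1,2)[OF deg triple, unfolded card]
  have "waring_rank 6 ?f = 4"
  proof (rule sextic_waring_rank_4_of_nondegenerate[OF refl])
    fix g :: "nat \<Rightarrow> complex"
    assume *: "\<And>j. j \<le> 3 \<Longrightarrow> g 0 * (coeff ?P j / of_nat (6 choose j))
      + g 1 * (coeff ?P (j + 1) / of_nat (6 choose (j + 1)))
      + g 2 * (coeff ?P (j + 2) / of_nat (6 choose (j + 2)))
      + g 3 * (coeff ?P (j + 3) / of_nat (6 choose (j + 3))) = 0"
    show "g 0 = 0 \<and> g 1 = 0 \<and> g 2 = 0 \<and> g 3 = 0"
      using *[of 0] *[of 1] *[of 2] *[of 3] by (simp add: eval_nat_numeral)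
  qed
  then show ?thesis using f by blast
qed

text \<open>The coefficients - 6 and 5 are chosen so that the derivative is 30 v^4 (v - 1) and P
  vanishes at 1.\<close>

lemma rank_5_one_double_root:
  "\<exists>f. sextic_mult_le_2 f \<and> card (double_roots f) = 1 \<and> waring_rank 6 f = 5"
proof -
  let ?P = "[:1, 0, 0, 0, 0, - 6, 5 :: complex:]"
  have val: "poly ?P v = 1 - 6 * v ^ 5 + 5 * v ^ 6" "poly (pderiv ?P) v = 30 * v ^ 4 * (v - 1)"
    "poly (pderiv (pderiv ?P)) v = 150 * v ^ 4 - 120 * v ^ 3" for v
    by (simp_all add: pderiv_pCons algebra_simps eval_nat_numeral)
  have double: "v = 1" if "poly ?P v = 0" "poly (pderiv ?P) v = 0" for v
    using that unfolding val by auto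
  have triple: "\<not> (poly ?P v = 0 \<and> poly (pderiv ?P) v = 0 \<and> poly (pderiv (pderiv ?P)) v = 0)" for v
  proof (intro notI, elim conjE)
    assume *: "poly ?P v = 0" "poly (pderiv ?P) v = 0" "poly (pderiv (pderiv ?P)) v = 0"
    show False using double[OF *(1,2)] *(3) unfolding val by simp
  qed
  have "{v. poly ?P v = 0 \<and> poly (pderiv ?P) v = 0} = {1}"
  proof (intro equalityI subsetI)
    fix v assume "v \<in> {v. poly ?P v = 0 \<and> poly (pderiv ?P) v = 0}"
    then show "v \<in> {1}" using double by blast
  qed (auto simp: val)
  then have card: "card {v. poly ?P v = 0 \<and> poly (pderiv ?P) v = 0} = 1" by simp
  let ?f = "hom_poly 6 ?P var_x var_y"
  have deg: "degree ?P = 6" by simp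
  note f = sextic_form(1,2)[OF deg triple, unfolded card]
  have "finite {v. poly ?P v = 0}" by (rule poly_roots_finite) simp
  moreover have "1 \<in> {v. poly ?P v = 0}" by simp
  ultimately have "card (roots ?f) \<noteq> 0"
    unfolding sextic_form(3)[OF deg triple] by (metis card_0_eq empty_iff)
  then have "waring_rank 6 ?f = 5"
    using f(1) by (intro waring_rank_5_of_pure_coeffs[OF deg]) (auto simp: eval_nat_numeral le_Suc_eq)
  then show ?thesis using f by blast
qed

lemma sextic_form_rsquarefree:
  assumes "degree P = 6" "\<And>v. \<not> (poly P v = 0 \<and> poly (pderiv P) v = 0)"
  defines "f \<equiv> hom_poly 6 P var_x var_y"
  shows "sextic_mult_le_2 f" "card (roots f) = 6"
  using sextic_form(1,3)[of P] assms card_roots_rsquarefree[of P] by (auto simp: rsquarefree_roots)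

lemma rank_2_six_roots:
  "\<exists>f. sextic_mult_le_2 f \<and> card (roots f) = 6 \<and> waring_rank 6 f = 2"
proof -
  let ?P = "[:1, 0, 0, 0, 0, 0, 1 :: complex:]"
  let ?f = "hom_poly 6 ?P var_x var_y"
  have deg: "degree ?P = 6" by simp
  have "\<not> (poly ?P v = 0 \<and> poly (pderiv ?P) v = 0)" for v
    by (auto simp: pderiv_pCons)
  note f = sextic_form_rsquarefree[OF deg this]
  have "hom 6 ?P x y = (\<Sum>i<(2::nat). 1 * ([1, 0] ! i * x + [0, 1] ! i * y) ^ 6)" for x y
    unfolding hom_6 by (simp add: eval_nat_numeral)
  then have "waring_le 6 2 (hom 6 ?P)" by (rule waring_le_of_power_sum[rotated 3]) auto
  moreover obtain p where "p \<in> roots ?f" using f(2) by fastforce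
  ultimately have "waring_rank 6 ?f = 2"
    using sextic_rank_bounds(2)[OF f(1)] by (intro waring_rank_eqI) (auto simp: form_eval_hom_poly_var)
  then show ?thesis using f by blast
qed

text \<open>The form is x^6 + y^6 + (x + y)^6. A multiple root would again be a fifth root of unity,
  and the same fifth power argument excludes it.\<close>

lemma rank_3_six_roots:
  "\<exists>f. sextic_mult_le_2 f \<and> card (roots f) = 6 \<and> waring_rank 6 f = 3"
proof -
  let ?P = "[:2, 6, 15, 20, 15, 6, 2 :: complex:]"
  let ?f = "hom_poly 6 ?P var_x var_y"
  have deg: "degree ?P = 6" by simp
  have "\<not> (poly ?P v = 0 \<and> poly (pderiv ?P) v = 0)" for v
  proof
    assume *: "poly ?P v = 0 \<and> poly (pderiv ?P) v = 0"
    have val: "poly ?P v = 1 + v ^ 6 + (v + 1) ^ 6" "poly (pderiv ?P) v = 6 * (v ^ 5 + (v + 1) ^ 5)"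
      by (simp_all add: pderiv_pCons algebra_simps eval_nat_numeral)
    have e: "1 + v ^ 6 + (v + 1) ^ 6 = 0" "6 * (v ^ 5 + (v + 1) ^ 5) = 0"
      using * unfolding val by blast+
    have d: "(v + 1) ^ 5 = - (v ^ 5)" using e(2) by algebra
    have "1 + v ^ 6 + (v + 1) * (v + 1) ^ 5 = 0" using e(1) by algebra
    then have "1 + v ^ 6 + (v + 1) * - (v ^ 5) = 0" unfolding d .
    then have v5: "v ^ 5 = 1" by algebra
    have "v \<noteq> 1" using e(2) by auto
    moreover have "(v - 1) * (v ^ 4 + v ^ 3 + v ^ 2 + v + 1) = 0" using v5 by algebra
    ultimately have "v ^ 4 + v ^ 3 + v ^ 2 + v + 1 = 0" by simp
    then have "5 * (v ^ 2 * (v + 1)) = 2" using d v5 by algebra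
    then have "v ^ 2 * (v + 1) = 2 / 5" by (simp add: field_simps)
    moreover have "(v ^ 5) ^ 2 * (v + 1) ^ 5 = (v ^ 2 * (v + 1)) ^ 5"
      by (simp add: power_mult_distrib power_mult[symmetric])
    ultimately have "(v ^ 5) ^ 2 * (v + 1) ^ 5 = (2 / 5) ^ 5" by (simp only:)
    then show False using d v5 by (simp add: power_divide)
  qed
  note f = sextic_form_rsquarefree[OF deg this]
  have "hom 6 ?P x y = (\<Sum>i<(3::nat). 1 * ([1, 0, 1] ! i * x + [0, 1, 1] ! i * y) ^ 6)" for x y
    unfolding hom_6 by (simp add: eval_nat_numeral) algebra
  then have "waring_le 6 3 (hom 6 ?P)" by (rule waring_le_of_power_sum[rotated 3]) auto
  moreover have "\<not> waring_le 6 s (hom 6 ?P)" if "s < 3" for s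
  proof (rule not_waring_le_of_no_annihilator)
    fix g assume "annihilates 6 ?P 2 g"
    then have g: "degree g \<le> 2" "\<And>j. j \<le> 4 \<Longrightarrow> coeff g 0 * (coeff ?P j / of_nat (6 choose j))
      + coeff g 1 * (coeff ?P (j + 1) / of_nat (6 choose (j + 1)))
      + coeff g 2 * (coeff ?P (j + 2) / of_nat (6 choose (j + 2))) = 0"
      by (simp_all add: annihilates_sextic_2[OF refl])
    have "coeff g 0 * 2 + coeff g 1 + coeff g 2 = 0" "coeff g 0 + coeff g 1 + coeff g 2 = 0"
      "coeff g 0 + coeff g 1 + coeff g 2 * 2 = 0"
      using g(2)[of 0] g(2)[of 1] g(2)[of 4] by (simp_all add: eval_nat_numeral)
    then have "coeff g 0 = 0" "coeff g 1 = 0" "coeff g 2 = 0" by algebra+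
    then show "g = 0" using g(1) by (intro poly_eq_0_of_coeffs[of g 2]) (auto simp: le_2_iff)
  qed (use that in auto)
  ultimately have "waring_rank 6 ?f = 3"
    by (intro waring_rank_eqI) (auto simp: form_eval_hom_poly_var)
  then show ?thesis using f by blast
qed

lemma rank_4_six_roots:
  "\<exists>f. sextic_mult_le_2 f \<and> card (roots f) = 6 \<and> waring_rank 6 f = 4"
proof -
  let ?P = "[:1, 0, 0, 1, 0, 0, 1 :: complex:]"
  let ?f = "hom_poly 6 ?P var_x var_y"
  have deg: "degree ?P = 6" by simp
  have "\<not> (poly ?P v = 0 \<and> poly (pderiv ?P) v = 0)" for v
  proof
    assume *: "poly ?P v = 0 \<and> poly (pderiv ?P) v = 0"
    have val: "poly ?P v = 1 + v ^ 3 + (v ^ 3) ^ 2" "poly (pderiv ?P) v = 3 * v ^ 2 * (1 + 2 * v ^ 3)"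
      by (simp_all add: pderiv_pCons algebra_simps eval_nat_numeral)
    have e: "1 + v ^ 3 + (v ^ 3) ^ 2 = 0" "v ^ 2 * (1 + 2 * v ^ 3) = 0"
      using * unfolding val by simp_all
    have "v \<noteq> 0" using e(1) by auto
    then have "1 + 2 * v ^ 3 = 0" using e(2) by simp
    then show False using e(1) by algebra
  qed
  note f = sextic_form_rsquarefree[OF deg this]
  have "waring_rank 6 ?f = 4"
  proof (rule sextic_waring_rank_4_of_nondegenerate[OF refl])
    fix g :: "nat \<Rightarrow> complex"
    assume *: "\<And>j. j \<le> 3 \<Longrightarrow> g 0 * (coeff ?P j / of_nat (6 choose j))
      + g 1 * (coeff ?P (j + 1) / of_nat (6 choose (j + 1)))
      + g 2 * (coeff ?P (j + 2) / of_nat (6 choose (j + 2)))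
      + g 3 * (coeff ?P (j + 3) / of_nat (6 choose (j + 3))) = 0"
    have "g 0 + g 3 / 20 = 0" "g 2 = 0" "g 1 = 0" "g 0 / 20 + g 3 = 0"
      using *[of 0] *[of 1] *[of 2] *[of 3] by (simp_all add: eval_nat_numeral)
    then show "g 0 = 0 \<and> g 1 = 0 \<and> g 2 = 0 \<and> g 3 = 0" by algebra
  qed
  then show ?thesis using f by blast
qed

lemma rank_5_six_roots:
  "\<exists>f. sextic_mult_le_2 f \<and> card (roots f) = 6 \<and> waring_rank 6 f = 5"
proof -
  let ?P = "[:1, 0, 0, 0, 0, 1, 1 :: complex:]"
  let ?f = "hom_poly 6 ?P var_x var_y"
  have deg: "degree ?P = 6" by simp
  have "\<not> (poly ?P v = 0 \<and> poly (pderiv ?P) v = 0)" for v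
  proof
    assume *: "poly ?P v = 0 \<and> poly (pderiv ?P) v = 0"
    have val: "poly ?P v = 1 + v ^ 5 + v ^ 6" "poly (pderiv ?P) v = v ^ 4 * (5 + 6 * v)"
      by (simp_all add: pderiv_pCons algebra_simps eval_nat_numeral)
    have e: "1 + v ^ 5 + v ^ 6 = 0" "v ^ 4 * (5 + 6 * v) = 0"
      using * unfolding val by simp_all
    have "v \<noteq> 0" using e(1) by auto
    then have "5 + 6 * v = 0" using e(2) by simp
    then show False using e(1) by algebra
  qed
  note f = sextic_form_rsquarefree[OF deg this]
  have "waring_rank 6 ?f = 5"
    using f by (intro waring_rank_5_of_pure_coeffs[OF deg]) (auto simp: eval_nat_numeral le_Suc_eq)
  then show ?thesis using f by blast
qed

lemma waring_rank_between:
  assumes "waring_le 6 n (form_eval f)" "\<And>s. s < m \<Longrightarrow> \<not> waring_le 6 s (form_eval f)"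
  shows "m \<le> waring_rank 6 f \<and> waring_rank 6 f \<le> n"
  using waring_rank_le[OF assms(1)] waring_rank_ge[OF assms] by blast

theorem theorem1p2:
  shows
   "(\<forall>f. sextic_mult_le_2 f \<and> card (double_roots f) = 3 \<longrightarrow> waring_rank 6 f = 4)
    \<and>
    ((\<forall>f. sextic_mult_le_2 f \<and> card (double_roots f) = 2
          \<longrightarrow> 3 \<le> waring_rank 6 f \<and> waring_rank 6 f \<le> 4) \<and>
     (\<forall>r \<in> {3, 4}. \<exists>f. sextic_mult_le_2 f \<and> card (double_roots f) = 2 \<and> waring_rank 6 f = r))
    \<and>
    ((\<forall>f. sextic_mult_le_2 f \<and> card (double_roots f) = 1
          \<longrightarrow> 3 \<le> waring_rank 6 f \<and> waring_rank 6 f \<le> 5) \<and>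
     (\<forall>r \<in> {3, 4, 5}. \<exists>f. sextic_mult_le_2 f \<and> card (double_roots f) = 1 \<and> waring_rank 6 f = r))
    \<and>
    ((\<forall>f. sextic_mult_le_2 f \<and> card (roots f) = 6
          \<longrightarrow> 2 \<le> waring_rank 6 f \<and> waring_rank 6 f \<le> 5) \<and>
     (\<forall>r \<in> {2, 3, 4, 5}. \<exists>f. sextic_mult_le_2 f \<and> card (roots f) = 6 \<and> waring_rank 6 f = r))"
proof (intro conjI)
  show "\<forall>f. sextic_mult_le_2 f \<and> card (double_roots f) = 3 \<longrightarrow> waring_rank 6 f = 4"
  proof (intro allI impI, elim conjE)
    fix f assume f: "sextic_mult_le_2 f" "card (double_roots f) = 3"
    obtain p q s where "p \<in> double_roots f" "q \<in> double_roots f" "s \<in> double_roots f"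
      "p \<noteq> q" "p \<noteq> s" "q \<noteq> s"
      using f(2) by (auto simp: card_3_iff)
    then show "waring_rank 6 f = 4"
      using sextic_two_double_roots_rank_le_4[OF f(1)] sextic_three_double_roots_rank_ge_4[OF f(1)]
      by (intro waring_rank_eqI) blast+
  qed
  show "\<forall>f. sextic_mult_le_2 f \<and> card (double_roots f) = 2
      \<longrightarrow> 3 \<le> waring_rank 6 f \<and> waring_rank 6 f \<le> 4"
  proof (intro allI impI, elim conjE)
    fix f assume f: "sextic_mult_le_2 f" "card (double_roots f) = 2"
    obtain p q where "p \<in> double_roots f" "q \<in> double_roots f" "p \<noteq> q"
      using f(2) by (auto simp: card_2_iff)
    then show "3 \<le> waring_rank 6 f \<and> waring_rank 6 f \<le> 4"
      using sextic_two_double_roots_rank_le_4[OF f(1)] sextic_double_root_rank_ge_3[OF f(1)]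
      by (intro waring_rank_between) blast+
  qed
  show "\<forall>f. sextic_mult_le_2 f \<and> card (double_roots f) = 1
      \<longrightarrow> 3 \<le> waring_rank 6 f \<and> waring_rank 6 f \<le> 5"
  proof (intro allI impI, elim conjE)
    fix f assume f: "sextic_mult_le_2 f" "card (double_roots f) = 1"
    obtain p where "p \<in> double_roots f" using f(2) by (auto simp: card_1_singleton_iff)
    then show "3 \<le> waring_rank 6 f \<and> waring_rank 6 f \<le> 5"
      using sextic_rank_bounds(1)[OF f(1)] sextic_double_root_rank_ge_3[OF f(1)]
        double_roots_subset_roots[of f]
      by (intro waring_rank_between) blast+
  qed
  show "\<forall>f. sextic_mult_le_2 f \<and> card (roots f) = 6
      \<longrightarrow> 2 \<le> waring_rank 6 f \<and> waring_rank 6 f \<le> 5"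
  proof (intro allI impI, elim conjE)
    fix f assume f: "sextic_mult_le_2 f" "card (roots f) = 6"
    obtain p where "p \<in> roots f" using f(2) by fastforce
    then show "2 \<le> waring_rank 6 f \<and> waring_rank 6 f \<le> 5"
      using sextic_rank_bounds[OF f(1)] by (intro waring_rank_between) blast+
  qed
qed (use rank_3_two_double_roots rank_4_two_double_roots rank_3_one_double_root
    rank_4_one_double_root rank_5_one_double_root rank_2_six_roots rank_3_six_roots
    rank_4_six_roots rank_5_six_roots in simp_all)

end
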